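(* Let $k,n\ge3$ and $g\ge1$. Let $H$ be a group, and let $\rho_H:B_{k,n}(\widehat\Sigma_g)\to H$ be a homomorphism. (i) The following conditions are equivalent: (a) $\rho_H$ factors through $\rho_{k,n}:B_{k,n}(\widehat\Sigma_g)\to B_{k,n}(\widehat\Sigma_g)/\Gamma_3(B_{k,n}(\widehat\Sigma_g))$; (b) the restriction of $\rho_H$ to $B_{k,n}$ (i.e. $\rho_H\circ\iota_{k,n}$) factors through $r_{k,n}:B_{k,n}\to B_{k,n}/\Gamma_2(B_{k,n})$; (c) there exist $\sigma,\tilde\sigma\in H$ such that $\rho_H(S)=\{\sigma\}$ and $\rho_H(\widetilde S)=\{\tilde\sigma\}$. (ii) There exists an injective homomorphism $\alpha_{k,n}:B_{k,n}/\Gamma_2(B_{k,n})\to B_{k,n}(\widehat\Sigma_g)/\Gamma_3(B_{k,n}(\widehat\Sigma_g))$ for which $\alpha_{k,n}\circ r_{k,n}=\rho_{k,n}\circ\iota_{k,n}$ and whose image is the centre of $B_{k,n}(\widehat\Sigma_g)/\Gamma_3(B_{k,n}(\widehat\Sigma_g))$. (iii) Let $\rho_{H,3}:B_{k,n}(\widehat\Sigma_g)/\Gamma_3(B_{k,n}(\widehat\Sigma_g))\to H$ be a homomorphism, and let $\rho_{H,2}=\rho_{H,3}\circ\alpha_{k,n}:B_{k,n}/\Gamma_2(B_{k,n})\to H$. Then $\rho_{H,3}$ is injective if and only if $\rho_{H,2}$ is injective. (iv) Let $\rho_{H,2}:B_{k,n}/\Gamma_2(B_{k,n})\to H$ be a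 homomorphism such that $\rho_H\circ\iota_{k,n}=\rho_{H,2}\circ r_{k,n}$. Then there exists a homomorphism $\rho_{H,3}:B_{k,n}(\widehat\Sigma_g)/\Gamma_3(B_{k,n}(\widehat\Sigma_g))\to H$ such that $\rho_{H,3}\circ\rho_{k,n}=\rho_H$ and $\rho_{H,2}=\rho_{H,3}\circ\alpha_{k,n}$. Furthermore, $\rho_{H,3}$ is injective if and only if $\rho_{H,2}$ is injective. In particular, if $\rho_{H,2}$ is injective and $\rho_H$ is surjective then $\rho_{H,3}$ is an isomorphism.
   Context: For a connected surface $\Sigma$, $B_{k,n}(\Sigma)=\pi_1(\mathbb F_{k+n}(\Sigma)/(S_k\times S_n))$, where $\mathbb F_m(\Sigma)=\{(x_1,\dots,x_m)\in\Sigma^m: x_i\neq x_j\ (i\ne j)\}$; $B_{k,n}=B_{k,n}(\mathbb D^2)$. $\widehat\Sigma_g$ is a compact connected orientable surface of genus $g$ with one boundary component. $\Gamma_1(G)=G$, $\Gamma_i(G)=[G,\Gamma_{i-1}(G)]$; $[x,y]=xyx^{-1}y^{-1}$, $x^y=y^{-1}xy$. $\rho_{k,n}$ and $r_{k,n}$ are the canonical projections, and $\iota_{k,n}:B_{k,n}\to B_{k,n}(\widehat\Sigma_g)$ is the natural inclusion induced by embedding a disc in $\widehat\Sigma_g$. Presentation of $B_{k,n}(\widehat\Sigma_g)$. Generators: $S=\{\sigma_1,\dots,\sigma_{k-1}\}$, $\widetilde S=\{\tilde\sigma_1,\dots,\tilde\sigma_{n-1}\}$, $AB=\{a_1,b_1,\dots,a_g,b_g\}$,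 $\widetilde{AB}=\{\tilde a_1,\tilde b_1,\dots,\tilde a_g,\tilde b_g\}$, $Z=\{\zeta_1,\dots,\zeta_n\}$. Write $c<d$ for $c\in\{a_i,b_i\}$, $d\in\{a_j,b_j\}$, $i<j$. Relations (for all indices for which they make sense): (a) $\sigma_i\sigma_j=\sigma_j\sigma_i$ for $|i-j|\ge2$; $\sigma_i\sigma_{i+1}\sigma_i=\sigma_{i+1}\sigma_i\sigma_{i+1}$; $c\sigma_i=\sigma_ic$ for $i\neq1$, $c\in AB\cup Z$; $c\sigma_1c\sigma_1=\sigma_1c\sigma_1c$ for $c\in AB\cup Z$; $a_i\sigma_1b_i=\sigma_1b_i\sigma_1a_i\sigma_1$; $\sigma_1^{-1}c\sigma_1$ commutes with $d$ for $c,d\in AB$, $c<d$; $\sigma_1^{-1}\zeta_i\sigma_1$ commutes with every $c\in AB$, and with $\zeta_j$ for $i<j$. (b) The relations of (a) among $S\cup AB$ only, with $k$ replaced by $n$ and $\sigma_i,a_i,b_i$ by $\tilde\sigma_i,\tilde a_i,\tilde b_i$. (c) $\tilde\sigma_i,\tilde a_i,\tilde b_i$ commute with every $\sigma_j$; $\tilde\sigma_i$ commutes with $a_j,b_j$; $\tilde\sigma_i\zeta_{i+1}\tilde\sigma_i^{-1}=\zeta_i$; $\tilde\sigma_i\zeta_i\tilde\sigma_i^{-1}=\zeta_i^{-1}\zeta_{i+1}\zeta_i$; $\tilde\sigma_i\zeta_j\tilde\sigma_i^{-1}=\zeta_j$ for $j\ne i,i+1$; for $(\tilde x,x)=(\tilde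 a_i,a_i)$ or $(\tilde b_i,b_i)$: $\tilde x\zeta_1\tilde x^{-1}=\zeta_1^{x\zeta_1}$, $\tilde x\zeta_j\tilde x^{-1}=\zeta_j^{[x^{-1},\zeta_1^{-1}]}$ for $j\ne1$, $\tilde xx\tilde x^{-1}=\zeta_1^{-1}x\zeta_1$, and for $d\in\{a_j,b_j\}$, $\tilde xd\tilde x^{-1}=d^{[x^{-1},\zeta_1^{-1}]}$ if $i>j$, $\tilde xd\tilde x^{-1}=d$ if $j>i$; $\tilde a_ib_i\tilde a_i^{-1}=b_i\zeta_1$; $\tilde b_ia_i\tilde b_i^{-1}=\zeta_1^{-1}a_i[b_i^{-1},\zeta_1^{-1}]$. For $g=0$ (no $AB$, $\widetilde{AB}$) this is a presentation of $B_{k,n}$, and $\iota_{k,n}$ sends each generator to the generator of the same name. *)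

theory Defs
  imports "HOL-Analysis.Analysis" "HOL-Algebra.Generated_Groups" "HOL-Algebra.Coset"
begin

section \<open>Quotient topologies\<close>

definition quotient_topology :: "'a topology \<Rightarrow> ('a \<Rightarrow> 'b) \<Rightarrow> 'b topology" where
  "quotient_topology X q =
     topology (\<lambda>U. U \<subseteq> q ` topspace X \<and> openin X {x \<in> topspace X. q x \<in> U})"

lemma openin_quotient_topology:
  "openin (quotient_topology X q) U \<longleftrightarrow>
     U \<subseteq> q ` topspace X \<and> openin X {x \<in> topspace X. q x \<in> U}"
proof -
  have "istopology (\<lambda>U. U \<subseteq> q ` topspace X \<and> openin X {x \<in> topspace X. q x \<in> U})"
    unfolding istopology_def
  proof (rule conjI; clarify)
    fix S T
    assume "S \<subseteq> q ` topspace X" and S: "openin X {x \<in> topspace X. q x \<in> S}"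
      and T: "openin X {x \<in> topspace X. q x \<in> T}"
    have "{x \<in> topspace X. q x \<in> S \<inter> T} =
        {x \<in> topspace X. q x \<in> S} \<inter> {x \<in> topspace X. q x \<in> T}" by auto
    then show "S \<inter> T \<subseteq> q ` topspace X \<and> openin X {x \<in> topspace X. q x \<in> S \<inter> T}"
      using S T \<open>S \<subseteq> q ` topspace X\<close> by auto
  next
    fix K
    assume K: "\<forall>S\<in>K. S \<subseteq> q ` topspace X \<and> openin X {x \<in> topspace X. q x \<in> S}"
    have "{x \<in> topspace X. q x \<in> \<Union>K} = (\<Union>S\<in>K. {x \<in> topspace X. q x \<in> S})" by auto
    then show "\<Union>K \<subseteq> q ` topspace X \<and> openin X {x \<in> topspace X. q x \<in> \<Union>K}"
      using K by auto
  qed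
  then show ?thesis
    by (simp add: quotient_topology_def)
qed

lemma topspace_quotient_topology [simp]: "topspace (quotient_topology X q) = q ` topspace X"
proof (rule antisym)
  show "topspace (quotient_topology X q) \<subseteq> q ` topspace X"
    using openin_quotient_topology[of X q] by (meson openin_topspace)
  have "{x \<in> topspace X. q x \<in> q ` topspace X} = topspace X" by auto
  then show "q ` topspace X \<subseteq> topspace (quotient_topology X q)"
    using openin_quotient_topology[of X q "q ` topspace X"]
    by (metis openin_subset openin_topspace order_refl)
qed

lemma quotient_map_quotient_topology: "quotient_map X (quotient_topology X q) q"
  by (auto simp: quotient_map_def openin_quotient_topology)


section \<open>The fundamental group of an abstract topological space\<close>

definition loop_at :: "'a topology \<Rightarrow> 'a \<Rightarrow> (real \<Rightarrow> 'a) \<Rightarrow> bool" where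
  "loop_at X x f \<longleftrightarrow> pathin X f \<and> f 0 = x \<and> f 1 = x"

definition loop_homotopic :: "'a topology \<Rightarrow> 'a \<Rightarrow> (real \<Rightarrow> 'a) \<Rightarrow> (real \<Rightarrow> 'a) \<Rightarrow> bool" where
  "loop_homotopic X x = homotopic_with (\<lambda>h. h 0 = x \<and> h 1 = x) (top_of_set {0..1}) X"

definition loop_join :: "(real \<Rightarrow> 'a) \<Rightarrow> (real \<Rightarrow> 'a) \<Rightarrow> real \<Rightarrow> 'a" where
  "loop_join f g = (\<lambda>t. if t \<le> 1/2 then f (2 * t) else g (2 * t - 1))"

definition loop_class :: "'a topology \<Rightarrow> 'a \<Rightarrow> (real \<Rightarrow> 'a) \<Rightarrow> (real \<Rightarrow> 'a) set" where
  "loop_class X x f = {h. loop_homotopic X x f h}"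

definition fundamental_group :: "'a topology \<Rightarrow> 'a \<Rightarrow> (real \<Rightarrow> 'a) set monoid" where
  "fundamental_group X x =
     \<lparr>carrier = {loop_class X x f |f. loop_at X x f},
      mult = (\<lambda>A B. \<Union>f\<in>A. \<Union>g\<in>B. loop_class X x (loop_join f g)),
      one = loop_class X x (\<lambda>_. x)\<rparr>"

text \<open>The map induced on fundamental groups by \<open>\<phi>\<close>; \<open>y\<close> is the base point of the target.\<close>

definition induced_hom ::
    "'b topology \<Rightarrow> 'b \<Rightarrow> ('a \<Rightarrow> 'b) \<Rightarrow> (real \<Rightarrow> 'a) set \<Rightarrow> (real \<Rightarrow> 'b) set" where
  "induced_hom Y y \<phi> A = (\<Union>f\<in>A. loop_class Y y (\<phi> \<circ> f))"

lemma loop_homotopic_loops: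
  assumes "loop_homotopic X x f g" shows "loop_at X x f" "loop_at X x g"
  using assms homotopic_with_imp_continuous_maps[of _ "top_of_set {0..1}" X f g]
    homotopic_with_imp_property[of _ "top_of_set {0..1}" X f g]
  unfolding loop_homotopic_def loop_at_def pathin_def by blast+

lemma loop_homotopic_refl: "loop_at X x f \<Longrightarrow> loop_homotopic X x f f"
  by (simp add: loop_homotopic_def loop_at_def pathin_def)

lemma loop_homotopic_sym: "loop_homotopic X x f g \<Longrightarrow> loop_homotopic X x g f"
  by (simp add: loop_homotopic_def homotopic_with_sym)

lemma loop_homotopic_trans:
  "loop_homotopic X x f g \<Longrightarrow> loop_homotopic X x g h \<Longrightarrow> loop_homotopic X x f h"
  unfolding loop_homotopic_def by (rule homotopic_with_trans)

lemma loop_class_eq: "loop_homotopic X x f g \<Longrightarrow> loop_class X x f = loop_class X x g"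
  unfolding loop_class_def by (blast intro: loop_homotopic_sym loop_homotopic_trans)

lemma square_topology:
  "prod_topology (top_of_set {0..1::real}) (top_of_set {0..1::real}) = top_of_set ({0..1} \<times> {0..1})"
  by (simp add: prod_topology_subtopology_eu)

lemma loop_homotopic_reparam:
  assumes f: "pathin X f"
    and cont: "continuous_on {0..1} \<phi>" "continuous_on {0..1} \<psi>"
    and im: "\<phi> ` {0..1} \<subseteq> {0..1}" "\<psi> ` {0..1} \<subseteq> {0..1}"
    and ends: "\<phi> 0 = \<psi> 0" "\<phi> 1 = \<psi> 1" "f (\<phi> 0) = x" "f (\<phi> 1) = x"
  shows "loop_homotopic X x (f \<circ> \<phi>) (f \<circ> \<psi>)"
proof -
  define h where "h = (\<lambda>p::real \<times> real. (1 - fst p) * \<phi> (snd p) + fst p * \<psi> (snd p))"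
  have c: "continuous_on ({0..1} \<times> {0..1}) h"
    unfolding h_def
    by (intro continuous_intros continuous_on_compose2[OF cont(1)]
        continuous_on_compose2[OF cont(2)]) auto
  have i: "h p \<in> {0..1}" if "p \<in> {0..1} \<times> {0..1}" for p
  proof -
    have "\<phi> (snd p) \<in> {0..1}" "\<psi> (snd p) \<in> {0..1}" "fst p \<in> {0..1}"
      using im that by (auto simp: image_subset_iff)
    moreover have "convex {0..1::real}" by simp
    ultimately show ?thesis
      unfolding h_def using convexD_alt[of "{0..1::real}" "\<phi> (snd p)" "\<psi> (snd p)" "fst p"] by simp
  qed
  have "continuous_map (prod_topology (top_of_set {0..1}) (top_of_set {0..1})) (top_of_set {0..1}) h"
    unfolding square_topology using c i by (subst continuous_map_subtopology_eu) blast
  then have "continuous_map (prod_topology (top_of_set {0..1}) (top_of_set {0..1})) X (f \<circ> h)"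
    using f unfolding pathin_def by (rule continuous_map_compose)
  moreover have "h (0, s) = \<phi> s" "h (1, s) = \<psi> s" for s by (auto simp: h_def)
  moreover have "h (t, 0) = \<phi> 0" "h (t, 1) = \<phi> 1" for t
    using ends by (auto simp: h_def algebra_simps)
  ultimately show ?thesis
    unfolding loop_homotopic_def homotopic_with_def using ends
    by (intro exI[of _ "f \<circ> h"]) auto
qed

lemma loop_homotopic_join:
  assumes "loop_homotopic X x f f'" "loop_homotopic X x g g'"
  shows "loop_homotopic X x (loop_join f g) (loop_join f' g')"
proof -
  let ?I = "top_of_set {0..1::real}"
  obtain h1 where h1: "continuous_map (prod_topology ?I ?I) X h1"
      "\<And>s. h1 (0, s) = f s" "\<And>s. h1 (1, s) = f' s"
      "\<And>t. t \<in> {0..1} \<Longrightarrow> h1 (t, 0) = x \<and> h1 (t, 1) = x"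
    using assms(1) unfolding loop_homotopic_def homotopic_with_def by blast
  obtain h2 where h2: "continuous_map (prod_topology ?I ?I) X h2"
      "\<And>s. h2 (0, s) = g s" "\<And>s. h2 (1, s) = g' s"
      "\<And>t. t \<in> {0..1} \<Longrightarrow> h2 (t, 0) = x \<and> h2 (t, 1) = x"
    using assms(2) unfolding loop_homotopic_def homotopic_with_def by blast
  define h where "h = (\<lambda>p. if snd p \<le> 1/2 then (h1 \<circ> (\<lambda>p. (fst p, 2 * snd p))) p
                           else (h2 \<circ> (\<lambda>p. (fst p, 2 * snd p - 1))) p)"
  have eq: "prod_topology ?I ?I = top_of_set ({0..1} \<times> {0..1})"
    by (rule square_topology)
  have "continuous_map (prod_topology ?I ?I) X h"
    unfolding h_def
  proof (rule continuous_map_cases_le)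
    show "continuous_map (subtopology (prod_topology ?I ?I) {p \<in> topspace (prod_topology ?I ?I). snd p \<le> 1/2})
        X (h1 \<circ> (\<lambda>p. (fst p, 2 * snd p)))"
      by (rule continuous_map_compose[OF _ h1(1)])
        (auto simp: eq subtopology_subtopology intro!: continuous_intros)
    show "continuous_map (subtopology (prod_topology ?I ?I) {p \<in> topspace (prod_topology ?I ?I). 1/2 \<le> snd p})
        X (h2 \<circ> (\<lambda>p. (fst p, 2 * snd p - 1)))"
      by (rule continuous_map_compose[OF _ h2(1)])
        (auto simp: eq subtopology_subtopology intro!: continuous_intros)
    show "continuous_map (prod_topology ?I ?I) euclideanreal snd"
      by (auto simp: eq intro!: continuous_intros)
    show "continuous_map (prod_topology ?I ?I) euclideanreal (\<lambda>p. 1/2)"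
      by simp
    show "(h1 \<circ> (\<lambda>p. (fst p, 2 * snd p))) p = (h2 \<circ> (\<lambda>p. (fst p, 2 * snd p - 1))) p"
      if "p \<in> topspace (prod_topology ?I ?I)" "snd p = 1/2" for p
    proof -
      have "2 * snd p = 1" "fst p \<in> {0..1}" using that by auto
      then show ?thesis using h1(4)[of "fst p"] h2(4)[of "fst p"] by (simp only: o_apply) simp
    qed
  qed
  moreover have "h (0, s) = loop_join f g s" "h (1, s) = loop_join f' g' s" for s
    by (auto simp: h_def loop_join_def h1 h2)
  moreover have "h (t, 0) = x" "h (t, 1) = x" if "t \<in> {0..1}" for t
    using h1(4)[OF that] h2(4)[OF that] by (auto simp: h_def)
  ultimately show ?thesis
    unfolding loop_homotopic_def homotopic_with_def by (intro exI[of _ h]) auto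
qed

lemma loop_at_join: "loop_at X x f \<Longrightarrow> loop_at X x g \<Longrightarrow> loop_at X x (loop_join f g)"
  by (meson loop_homotopic_join loop_homotopic_loops(1) loop_homotopic_refl)

lemma loop_at_const: "x \<in> topspace X \<Longrightarrow> loop_at X x (\<lambda>_. x)"
  by (simp add: loop_at_def pathin_def)

lemma mult_loop_class:
  assumes "loop_at X x f" "loop_at X x g"
  shows "loop_class X x f \<otimes>\<^bsub>fundamental_group X x\<^esub> loop_class X x g = loop_class X x (loop_join f g)"
proof -
  have *: "loop_class X x (loop_join f' g') = loop_class X x (loop_join f g)"
    if "f' \<in> loop_class X x f" "g' \<in> loop_class X x g" for f' g'
  proof -
    have "loop_homotopic X x f f'" "loop_homotopic X x g g'"
      using that by (simp_all add: loop_class_def)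
    then show ?thesis by (metis loop_class_eq loop_homotopic_join)
  qed
  have "f \<in> loop_class X x f" "g \<in> loop_class X x g"
    using assms by (auto simp: loop_class_def loop_homotopic_refl)
  then have ne: "loop_class X x f \<noteq> {}" "loop_class X x g \<noteq> {}" by auto
  have "(\<Union>f'\<in>loop_class X x f. \<Union>g'\<in>loop_class X x g. loop_class X x (loop_join f' g')) =
      (\<Union>f'\<in>loop_class X x f. \<Union>g'\<in>loop_class X x g. loop_class X x (loop_join f g))"
    by (intro SUP_cong HOL.refl *)
  then show ?thesis using ne by (simp add: fundamental_group_def)
qed

lemma loop_class_carrier:
  "loop_at X x f \<Longrightarrow> loop_class X x f \<in> carrier (fundamental_group X x)"
  unfolding fundamental_group_def partial_object.simps mem_Collect_eq
  by (intro exI[of _ f] conjI HOL.refl)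

lemma loop_class_cases:
  assumes "A \<in> carrier (fundamental_group X x)"
  obtains f where "loop_at X x f" "A = loop_class X x f"
  using assms unfolding fundamental_group_def partial_object.simps mem_Collect_eq by (elim exE conjE)

theorem group_fundamental_group:
  assumes x: "x \<in> topspace X"
  shows "group (fundamental_group X x)"
proof -
  let ?G = "fundamental_group X x"
  have one: "\<one>\<^bsub>?G\<^esub> = loop_class X x (\<lambda>_. x)"
    by (simp add: fundamental_group_def)
  note const = loop_at_const[OF x]
  show ?thesis
  proof (rule groupI)
    fix A B assume "A \<in> carrier ?G" "B \<in> carrier ?G"
    then show "A \<otimes>\<^bsub>?G\<^esub> B \<in> carrier ?G"
      by (elim loop_class_cases) (simp add: mult_loop_class loop_at_join loop_class_carrier)
  next
    show "\<one>\<^bsub>?G\<^esub> \<in> carrier ?G" unfolding one by (rule loop_class_carrier[OF const])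
  next
    fix A B C assume "A \<in> carrier ?G" "B \<in> carrier ?G" "C \<in> carrier ?G"
    then obtain f g h where f: "loop_at X x f" "A = loop_class X x f"
      and g: "loop_at X x g" "B = loop_class X x g"
      and h: "loop_at X x h" "C = loop_class X x h" by (meson loop_class_cases)
    let ?p = "\<lambda>s::real. min (2 * s) (min (s + 1/4) ((s + 1)/2))"
    let ?F = "loop_join f (loop_join g h)"
    have F: "loop_at X x ?F" using f g h by (simp add: loop_at_join)
    have "loop_homotopic X x (?F \<circ> ?p) (?F \<circ> id)"
    proof (rule loop_homotopic_reparam)
      show "continuous_on {0..1} ?p" by (intro continuous_intros) auto
    qed (use F in \<open>auto simp: loop_at_def min_le_iff_disj\<close>)
    moreover have "?F \<circ> ?p = loop_join (loop_join f g) h"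
    proof
      fix s :: real
      consider "s \<le> 1/4" | "1/4 < s" "s \<le> 1/2" | "1/2 < s" by linarith
      then show "(?F \<circ> ?p) s = loop_join (loop_join f g) h s"
      proof cases
        case 1
        then have "?p s = 2 * s" by (auto simp: min_def)
        with 1 show ?thesis by (simp add: loop_join_def)
      next
        case 2
        then have "?p s = s + 1/4" by (auto simp: min_def)
        with 2 show ?thesis by (simp add: loop_join_def algebra_simps)
      next
        case 3
        then have "?p s = (s + 1)/2" by (auto simp: min_def)
        with 3 show ?thesis by (simp add: loop_join_def) (rule arg_cong[of _ _ h], simp add: field_simps)
      qed
    qed
    ultimately have "loop_class X x (loop_join (loop_join f g) h) = loop_class X x ?F"
      by (simp add: loop_class_eq)
    then show "A \<otimes>\<^bsub>?G\<^esub> B \<otimes>\<^bsub>?G\<^esub> C = A \<otimes>\<^bsub>?G\<^esub> (B \<otimes>\<^bsub>?G\<^esub> C)"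
      using f g h by (simp add: mult_loop_class loop_at_join)
  next
    fix A assume "A \<in> carrier ?G"
    then obtain f where f: "loop_at X x f" "A = loop_class X x f" by (rule loop_class_cases)
    let ?p = "\<lambda>s::real. max 0 (2 * s - 1)"
    have "loop_homotopic X x (f \<circ> ?p) (f \<circ> id)"
      using f by (intro loop_homotopic_reparam) (auto simp: loop_at_def intro!: continuous_intros)
    moreover have "f \<circ> ?p = loop_join (\<lambda>_. x) f"
    proof
      fix s :: real
      consider "s < 1/2" | "s = 1/2" | "1/2 < s" by linarith
      then show "(f \<circ> ?p) s = loop_join (\<lambda>_. x) f s"
        using f by cases (auto simp: loop_join_def loop_at_def)
    qed
    ultimately show "\<one>\<^bsub>?G\<^esub> \<otimes>\<^bsub>?G\<^esub> A = A"
      using f const by (simp add: one mult_loop_class loop_class_eq)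
  next
    fix A assume "A \<in> carrier ?G"
    then obtain f where f: "loop_at X x f" "A = loop_class X x f" by (rule loop_class_cases)
    let ?r = "\<lambda>s::real. 1 - s"
    have pf: "pathin X f" and f01: "f 0 = x" "f 1 = x" using f by (auto simp: loop_at_def)
    have "loop_homotopic X x (f \<circ> ?r) (f \<circ> ?r)"
      by (rule loop_homotopic_reparam[OF pf]) (auto simp: f01 intro!: continuous_intros)
    then have r: "loop_at X x (f \<circ> ?r)" by (rule loop_homotopic_loops)
    let ?p = "\<lambda>s::real. max (1 - 2 * s) (2 * s - 1)"
    have "loop_homotopic X x (f \<circ> ?p) (f \<circ> (\<lambda>_. 1))"
      by (rule loop_homotopic_reparam[OF pf]) (auto simp: f01 intro!: continuous_intros)
    moreover have "f \<circ> ?p = loop_join (f \<circ> ?r) f"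
    proof
      fix s :: real
      consider "s < 1/2" | "s = 1/2" | "1/2 < s" by linarith
      then show "(f \<circ> ?p) s = loop_join (f \<circ> ?r) f s"
        by cases (auto simp: loop_join_def f01)
    qed
    moreover have "f \<circ> (\<lambda>_. 1) = (\<lambda>_::real. x)" by (auto simp: f01)
    ultimately have "loop_class X x (f \<circ> ?r) \<otimes>\<^bsub>?G\<^esub> A = \<one>\<^bsub>?G\<^esub>"
      using f r by (simp add: one mult_loop_class loop_class_eq)
    then show "\<exists>B\<in>carrier ?G. B \<otimes>\<^bsub>?G\<^esub> A = \<one>\<^bsub>?G\<^esub>"
      using loop_class_carrier[OF r] by (rule bexI)
  qed
qed

lemma induced_hom_loop_class:
  assumes \<phi>: "continuous_map X Y \<phi>" and f: "loop_at X x f"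
  shows "induced_hom Y (\<phi> x) \<phi> (loop_class X x f) = loop_class Y (\<phi> x) (\<phi> \<circ> f)"
proof -
  have "loop_class Y (\<phi> x) (\<phi> \<circ> h) = loop_class Y (\<phi> x) (\<phi> \<circ> f)" if "h \<in> loop_class X x f" for h
  proof -
    have "loop_homotopic X x f h" using that by (simp add: loop_class_def)
    then have "loop_homotopic Y (\<phi> x) (\<phi> \<circ> f) (\<phi> \<circ> h)"
      unfolding loop_homotopic_def
      by (rule homotopic_with_compose_continuous_map_left[OF _ \<phi>]) auto
    then show ?thesis by (rule loop_class_eq[symmetric])
  qed
  then have "(\<Union>h\<in>loop_class X x f. loop_class Y (\<phi> x) (\<phi> \<circ> h)) =
      (\<Union>h\<in>loop_class X x f. loop_class Y (\<phi> x) (\<phi> \<circ> f))"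
    by (intro SUP_cong HOL.refl)
  moreover have "f \<in> loop_class X x f" using f by (simp add: loop_class_def loop_homotopic_refl)
  ultimately show ?thesis unfolding induced_hom_def by auto
qed

lemma induced_hom_in_hom:
  assumes \<phi>: "continuous_map X Y \<phi>"
  shows "induced_hom Y (\<phi> x) \<phi> \<in> hom (fundamental_group X x) (fundamental_group Y (\<phi> x))"
proof -
  have l: "loop_at Y (\<phi> x) (\<phi> \<circ> f)" if "loop_at X x f" for f
    using that \<phi> by (auto simp: loop_at_def pathin_def intro: continuous_map_compose)
  have j: "\<phi> \<circ> loop_join f g = loop_join (\<phi> \<circ> f) (\<phi> \<circ> g)" for f g
    by (auto simp: loop_join_def)
  show ?thesis
  proof (rule homI)
    fix A assume "A \<in> carrier (fundamental_group X x)"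
    then obtain f where f: "loop_at X x f" "A = loop_class X x f"
      by (rule loop_class_cases)
    then show "induced_hom Y (\<phi> x) \<phi> A \<in> carrier (fundamental_group Y (\<phi> x))"
      by (simp add: induced_hom_loop_class[OF \<phi>] l loop_class_carrier)
  next
    fix A B assume "A \<in> carrier (fundamental_group X x)" "B \<in> carrier (fundamental_group X x)"
    then obtain f g where f: "loop_at X x f" "A = loop_class X x f"
      and g: "loop_at X x g" "B = loop_class X x g"
      by (meson loop_class_cases)
    then show "induced_hom Y (\<phi> x) \<phi> (A \<otimes>\<^bsub>fundamental_group X x\<^esub> B) =
        induced_hom Y (\<phi> x) \<phi> A \<otimes>\<^bsub>fundamental_group Y (\<phi> x)\<^esub> induced_hom Y (\<phi> x) \<phi> B"
      by (simp add: mult_loop_class loop_at_join induced_hom_loop_class[OF \<phi>] l j)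
  qed
qed


section \<open>Mixed braid groups\<close>

definition config_space :: "nat \<Rightarrow> 'a topology \<Rightarrow> (nat \<Rightarrow> 'a) topology" where
  "config_space m X =
     subtopology (product_topology (\<lambda>_. X) {..<m}) {x. inj_on x {..<m}}"

text \<open>The copy of \<open>S\<^sub>k \<times> S\<^sub>n\<close> in the symmetric group on the indices \<open>0, \<dots>, k + n - 1\<close>.\<close>

definition block_perms :: "nat \<Rightarrow> nat \<Rightarrow> (nat \<Rightarrow> nat) set" where
  "block_perms k n = {\<pi>. \<pi> permutes {..<k + n} \<and> \<pi> ` {..<k} = {..<k}}"

definition block_orbit :: "nat \<Rightarrow> nat \<Rightarrow> (nat \<Rightarrow> 'a) \<Rightarrow> (nat \<Rightarrow> 'a) set" where
  "block_orbit k n x = {x \<circ> \<pi> |\<pi>. \<pi> \<in> block_perms k n}"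

definition mixed_config_space :: "nat \<Rightarrow> nat \<Rightarrow> 'a topology \<Rightarrow> (nat \<Rightarrow> 'a) set topology" where
  "mixed_config_space k n X = quotient_topology (config_space (k + n) X) (block_orbit k n)"

definition mixed_braid_group ::
    "nat \<Rightarrow> nat \<Rightarrow> 'a topology \<Rightarrow> (nat \<Rightarrow> 'a) \<Rightarrow> (real \<Rightarrow> (nat \<Rightarrow> 'a) set) set monoid" where
  "mixed_braid_group k n X p = fundamental_group (mixed_config_space k n X) (block_orbit k n p)"

definition push_config :: "nat \<Rightarrow> ('a \<Rightarrow> 'b) \<Rightarrow> (nat \<Rightarrow> 'a) \<Rightarrow> nat \<Rightarrow> 'b" where
  "push_config m e x = restrict (e \<circ> x) {..<m}"

text \<open>The homomorphism of mixed braid groups induced by an embedding \<open>e\<close> of surfaces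
  (target \<open>X\<close>), the base configuration \<open>p\<close> being carried to its image under \<open>e\<close>.\<close>

definition mixed_braid_map ::
    "nat \<Rightarrow> nat \<Rightarrow> 'b topology \<Rightarrow> ('a \<Rightarrow> 'b) \<Rightarrow> (nat \<Rightarrow> 'a) \<Rightarrow>
     (real \<Rightarrow> (nat \<Rightarrow> 'a) set) set \<Rightarrow> (real \<Rightarrow> (nat \<Rightarrow> 'b) set) set" where
  "mixed_braid_map k n X e p =
     induced_hom (mixed_config_space k n X) (block_orbit k n (push_config (k + n) e p))
       (\<lambda>C. push_config (k + n) e ` C)"

lemma continuous_map_push_config:
  assumes e: "continuous_map X Y e" "inj_on e (topspace X)"
  shows "continuous_map (config_space m X) (config_space m Y) (push_config m e)"
proof -
  have proj: "continuous_map (config_space m X) X (\<lambda>x. x i)" if "i < m" for i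
    unfolding config_space_def using that
    by (intro continuous_map_from_subtopology continuous_map_product_projection) simp
  have "continuous_map (config_space m X) Y (\<lambda>x. push_config m e x i)" if "i < m" for i
    using continuous_map_compose[OF proj[OF that] e(1)] that by (simp add: push_config_def o_def)
  moreover have "inj_on (push_config m e x) {..<m}" if "x \<in> topspace (config_space m X)" for x
  proof -
    have "inj_on x {..<m}" "x ` {..<m} \<subseteq> topspace X"
      using that by (auto simp: config_space_def)
    then show ?thesis
      by (simp add: push_config_def comp_inj_on inj_on_subset[OF e(2)])
  qed
  ultimately show ?thesis
    unfolding config_space_def[of m Y]
    by (auto simp: continuous_map_in_subtopology continuous_map_componentwise push_config_def)
qed

lemma push_config_block_orbit:
  "push_config (k + n) e ` block_orbit k n x = block_orbit k n (push_config (k + n) e x)"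
proof -
  have "push_config (k + n) e (x \<circ> \<pi>) = push_config (k + n) e x \<circ> \<pi>" if "\<pi> \<in> block_perms k n" for \<pi>
  proof
    fix i
    have "\<pi> permutes {..<k + n}" using that by (simp add: block_perms_def)
    then have "\<pi> i \<in> {..<k + n} \<longleftrightarrow> i \<in> {..<k + n}" by (rule permutes_in_image)
    then show "push_config (k + n) e (x \<circ> \<pi>) i = (push_config (k + n) e x \<circ> \<pi>) i"
      by (simp add: push_config_def restrict_def)
  qed
  then show ?thesis unfolding block_orbit_def by force
qed

lemma mixed_braid_map_in_hom:
  assumes e: "continuous_map X Y e" "inj_on e (topspace X)"
  shows "mixed_braid_map k n Y e p \<in>
    hom (mixed_braid_group k n X p) (mixed_braid_group k n Y (push_config (k + n) e p))"
proof -
  have q: "continuous_map (config_space (k + n) Y) (mixed_config_space k n Y) (block_orbit k n)"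
    unfolding mixed_config_space_def
    by (rule quotient_imp_continuous_map[OF quotient_map_quotient_topology])
  have "continuous_map (config_space (k + n) X) (mixed_config_space k n Y)
      ((\<lambda>C. push_config (k + n) e ` C) \<circ> block_orbit k n)"
    using continuous_map_compose[OF continuous_map_push_config[OF e] q]
    by (simp add: o_def push_config_block_orbit)
  then have "continuous_map (mixed_config_space k n X) (mixed_config_space k n Y)
      (\<lambda>C. push_config (k + n) e ` C)"
    unfolding mixed_config_space_def[of k n X]
    by (rule continuous_compose_quotient_map[OF quotient_map_quotient_topology])
  from induced_hom_in_hom[OF this, of "block_orbit k n p"] show ?thesis
    by (simp add: mixed_braid_map_def mixed_braid_group_def push_config_block_orbit)
qed


section \<open>The surfaces\<close>

abbreviation disc :: "complex topology" where
  "disc \<equiv> top_of_set (cball 0 1)"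

text \<open>The outer boundary circle of the annulus \<open>{z. 1/2 \<le> \<bar>z\<bar> \<le> 1}\<close> is subdivided into \<open>4g\<close> arcs,
  which are identified following the word
  \<open>a\<^sub>0 b\<^sub>0 a\<^sub>0\<inverse> b\<^sub>0\<inverse> \<dots> a\<^sub>g\<^sub>-\<^sub>1 b\<^sub>g\<^sub>-\<^sub>1 a\<^sub>g\<^sub>-\<^sub>1\<inverse> b\<^sub>g\<^sub>-\<^sub>1\<inverse>\<close>.
  The quotient is the compact connected orientable surface of genus \<open>g\<close> with one boundary
  component (the inner circle), which is unique up to homeomorphism.\<close>

definition polygon_point :: "nat \<Rightarrow> real \<Rightarrow> complex" where
  "polygon_point g s = cis (2 * pi * s / (4 * real g))"

definition edge_glue :: "nat \<Rightarrow> complex \<Rightarrow> complex \<Rightarrow> bool" where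
  "edge_glue g z w \<longleftrightarrow> (\<exists>i<g. \<exists>t\<in>{0..1}.
     z = polygon_point g (4 * real i + t) \<and> w = polygon_point g (4 * real i + 3 - t) \<or>
     z = polygon_point g (4 * real i + 1 + t) \<and> w = polygon_point g (4 * real i + 4 - t))"

definition one_holed_surface :: "nat \<Rightarrow> 'a topology \<Rightarrow> bool" where
  "one_holed_surface g X \<longleftrightarrow>
     (\<exists>q. quotient_map (top_of_set {z::complex. 1/2 \<le> norm z \<and> norm z \<le> 1}) X q \<and>
        (\<forall>z w. 1/2 \<le> norm z \<and> norm z \<le> 1 \<and> 1/2 \<le> norm w \<and> norm w \<le> 1 \<longrightarrow>
           (q z = q w \<longleftrightarrow> equivclp (edge_glue g) z w)))"


section \<open>Group presentations\<close>

text \<open>A word is a list of letters; the letter \<open>(x, True)\<close> stands for \<open>x\<close> and \<open>(x, False)\<close> for its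
  inverse.\<close>

type_synonym 'x word = "('x \<times> bool) list"

definition word_inv :: "'x word \<Rightarrow> 'x word" where
  "word_inv w = rev (map (\<lambda>(x, b). (x, \<not> b)) w)"

definition word_comm :: "'x word \<Rightarrow> 'x word \<Rightarrow> 'x word" where
  "word_comm u v = u @ v @ word_inv u @ word_inv v"

definition word_conj :: "'x word \<Rightarrow> 'x word \<Rightarrow> 'x word" where
  "word_conj u v = word_inv v @ u @ v"

definition word_eval :: "('g, 'm) monoid_scheme \<Rightarrow> ('x \<Rightarrow> 'g) \<Rightarrow> 'x word \<Rightarrow> 'g" where
  "word_eval G \<gamma> w =
     foldr (\<lambda>(x, b) h. (if b then \<gamma> x else inv\<^bsub>G\<^esub> \<gamma> x) \<otimes>\<^bsub>G\<^esub> h) w \<one>\<^bsub>G\<^esub>"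

text \<open>Equality of words in the group with generators \<open>X\<close> and relations \<open>R\<close>.\<close>

inductive word_eq :: "'x set \<Rightarrow> ('x word \<Rightarrow> 'x word \<Rightarrow> bool) \<Rightarrow> 'x word \<Rightarrow> 'x word \<Rightarrow> bool"
  for X R where
  relation: "R u v \<Longrightarrow> word_eq X R u v"
| cancel: "x \<in> X \<Longrightarrow> word_eq X R [(x, b), (x, \<not> b)] []"
| refl: "word_eq X R u u"
| sym: "word_eq X R u v \<Longrightarrow> word_eq X R v u"
| trans: "word_eq X R u v \<Longrightarrow> word_eq X R v w \<Longrightarrow> word_eq X R u w"
| append: "word_eq X R u u' \<Longrightarrow> word_eq X R v v' \<Longrightarrow> word_eq X R (u @ v) (u' @ v')"

text \<open>\<open>G\<close> is presented by the generators \<open>X\<close> and relations \<open>R\<close>, where \<open>\<gamma> x\<close> is the element of \<open>G\<close>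
  named by the generator \<open>x\<close>.\<close>

definition has_presentation ::
    "('g, 'm) monoid_scheme \<Rightarrow> ('x \<Rightarrow> 'g) \<Rightarrow> 'x set \<Rightarrow> ('x word \<Rightarrow> 'x word \<Rightarrow> bool) \<Rightarrow> bool" where
  "has_presentation G \<gamma> X R \<longleftrightarrow>
     group G \<and> \<gamma> ` X \<subseteq> carrier G \<and> generate G (\<gamma> ` X) = carrier G \<and>
     (\<forall>u\<in>lists (X \<times> UNIV). \<forall>v\<in>lists (X \<times> UNIV).
        word_eval G \<gamma> u = word_eval G \<gamma> v \<longleftrightarrow> word_eq X R u v)"


section \<open>The presentation of the mixed braid groups\<close>

text \<open>For \<open>g \<ge> 1\<close> the generators and relations below present the mixed braid group of the genus
  \<open>g\<close> surface with one boundary component, and for \<open>g = 0\<close> that of the disc. The generators are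
  \<open>\<sigma>\<^sub>i, \<sigma>\<^sub>i~, a\<^sub>i, b\<^sub>i, a\<^sub>i~, b\<^sub>i~, \<zeta>\<^sub>i\<close>, with indices
  starting at 1; the suffix \<open>T\<close> stands for the tilde.\<close>

datatype mixed_gen =
  Sig nat | SigT nat | GenA nat | GenB nat | GenAT nat | GenBT nat | Zet nat

definition mixed_gens :: "nat \<Rightarrow> nat \<Rightarrow> nat \<Rightarrow> mixed_gen set" where
  "mixed_gens k n g =
     Sig ` {1..<k} \<union> SigT ` {1..<n} \<union> GenA ` {1..g} \<union> GenB ` {1..g} \<union>
     GenAT ` {1..g} \<union> GenBT ` {1..g} \<union> Zet ` {1..n}"

abbreviation letter :: "'x \<Rightarrow> 'x word" where
  "letter x \<equiv> [(x, True)]"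

text \<open>The relations among \<open>m - 1\<close> braid generators \<open>s\<^sub>i\<close> and \<open>2g\<close> handle generators \<open>a\<^sub>i, b\<^sub>i\<close>; they are
  used once without and once with tildes.\<close>

inductive surface_rel ::
    "nat \<Rightarrow> nat \<Rightarrow> (nat \<Rightarrow> 'x word) \<Rightarrow> (nat \<Rightarrow> 'x word) \<Rightarrow> (nat \<Rightarrow> 'x word) \<Rightarrow> 'x word \<Rightarrow> 'x word \<Rightarrow> bool"
  for m g s a b where
  "i \<in> {1..<m} \<Longrightarrow> j \<in> {1..<m} \<Longrightarrow> i + 2 \<le> j \<or> j + 2 \<le> i \<Longrightarrow>
     surface_rel m g s a b (s i @ s j) (s j @ s i)"
| "i \<in> {1..<m} \<Longrightarrow> i + 1 \<in> {1..<m} \<Longrightarrow>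
     surface_rel m g s a b (s i @ s (i + 1) @ s i) (s (i + 1) @ s i @ s (i + 1))"
| "i \<in> {1..<m} \<Longrightarrow> i \<noteq> 1 \<Longrightarrow> j \<in> {1..g} \<Longrightarrow> c \<in> {a j, b j} \<Longrightarrow>
     surface_rel m g s a b (c @ s i) (s i @ c)"
| "1 \<in> {1..<m} \<Longrightarrow> j \<in> {1..g} \<Longrightarrow> c \<in> {a j, b j} \<Longrightarrow>
     surface_rel m g s a b (c @ s 1 @ c @ s 1) (s 1 @ c @ s 1 @ c)"
| "1 \<in> {1..<m} \<Longrightarrow> i \<in> {1..g} \<Longrightarrow>
     surface_rel m g s a b (a i @ s 1 @ b i) (s 1 @ b i @ s 1 @ a i @ s 1)"
| "1 \<in> {1..<m} \<Longrightarrow> i \<in> {1..g} \<Longrightarrow> j \<in> {1..g} \<Longrightarrow> i < j \<Longrightarrow> c \<in> {a i, b i} \<Longrightarrow> d \<in> {a j, b j} \<Longrightarrow>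
     surface_rel m g s a b ((word_inv (s 1) @ c @ s 1) @ d) (d @ (word_inv (s 1) @ c @ s 1))"

context
begin

qualified abbreviation "\<sigma> i \<equiv> letter (Sig i)"
qualified abbreviation "\<sigma>T i \<equiv> letter (SigT i)"
qualified abbreviation "a i \<equiv> letter (GenA i)"
qualified abbreviation "b i \<equiv> letter (GenB i)"
qualified abbreviation "aT i \<equiv> letter (GenAT i)"
qualified abbreviation "bT i \<equiv> letter (GenBT i)"
qualified abbreviation "\<zeta> i \<equiv> letter (Zet i)"

inductive mixed_rel :: "nat \<Rightarrow> nat \<Rightarrow> nat \<Rightarrow> mixed_gen word \<Rightarrow> mixed_gen word \<Rightarrow> bool"
  for k n g where
  "surface_rel k g \<sigma> a b u v \<Longrightarrow> mixed_rel k n g u v"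
| "l \<in> {1..n} \<Longrightarrow> i \<in> {1..<k} \<Longrightarrow> i \<noteq> 1 \<Longrightarrow> mixed_rel k n g (\<zeta> l @ \<sigma> i) (\<sigma> i @ \<zeta> l)"
| "l \<in> {1..n} \<Longrightarrow> 1 \<in> {1..<k} \<Longrightarrow>
     mixed_rel k n g (\<zeta> l @ \<sigma> 1 @ \<zeta> l @ \<sigma> 1) (\<sigma> 1 @ \<zeta> l @ \<sigma> 1 @ \<zeta> l)"
| "l \<in> {1..n} \<Longrightarrow> 1 \<in> {1..<k} \<Longrightarrow> j \<in> {1..g} \<Longrightarrow> c \<in> {a j, b j} \<Longrightarrow>
     mixed_rel k n g ((word_inv (\<sigma> 1) @ \<zeta> l @ \<sigma> 1) @ c) (c @ (word_inv (\<sigma> 1) @ \<zeta> l @ \<sigma> 1))"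
| "i \<in> {1..n} \<Longrightarrow> j \<in> {1..n} \<Longrightarrow> i < j \<Longrightarrow> 1 \<in> {1..<k} \<Longrightarrow>
     mixed_rel k n g ((word_inv (\<sigma> 1) @ \<zeta> i @ \<sigma> 1) @ \<zeta> j) (\<zeta> j @ (word_inv (\<sigma> 1) @ \<zeta> i @ \<sigma> 1))"

| "surface_rel n g \<sigma>T aT bT u v \<Longrightarrow> mixed_rel k n g u v"

| "i \<in> {1..<n} \<Longrightarrow> j \<in> {1..<k} \<Longrightarrow> mixed_rel k n g (\<sigma>T i @ \<sigma> j) (\<sigma> j @ \<sigma>T i)"
| "i \<in> {1..g} \<Longrightarrow> x \<in> {aT i, bT i} \<Longrightarrow> j \<in> {1..<k} \<Longrightarrow> mixed_rel k n g (x @ \<sigma> j) (\<sigma> j @ x)"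
| "i \<in> {1..<n} \<Longrightarrow> j \<in> {1..g} \<Longrightarrow> c \<in> {a j, b j} \<Longrightarrow> mixed_rel k n g (\<sigma>T i @ c) (c @ \<sigma>T i)"
| "i \<in> {1..<n} \<Longrightarrow> mixed_rel k n g (\<sigma>T i @ \<zeta> (i + 1) @ word_inv (\<sigma>T i)) (\<zeta> i)"
| "i \<in> {1..<n} \<Longrightarrow> mixed_rel k n g
     (\<sigma>T i @ \<zeta> i @ word_inv (\<sigma>T i)) (word_inv (\<zeta> i) @ \<zeta> (i + 1) @ \<zeta> i)"
| "i \<in> {1..<n} \<Longrightarrow> j \<in> {1..n} \<Longrightarrow> j \<noteq> i \<Longrightarrow> j \<noteq> i + 1 \<Longrightarrow>
     mixed_rel k n g (\<sigma>T i @ \<zeta> j @ word_inv (\<sigma>T i)) (\<zeta> j)"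

| "i \<in> {1..g} \<Longrightarrow> (xT, x) \<in> {(aT i, a i), (bT i, b i)} \<Longrightarrow> 1 \<in> {1..n} \<Longrightarrow>
     mixed_rel k n g (xT @ \<zeta> 1 @ word_inv xT) (word_conj (\<zeta> 1) (x @ \<zeta> 1))"
| "i \<in> {1..g} \<Longrightarrow> (xT, x) \<in> {(aT i, a i), (bT i, b i)} \<Longrightarrow> j \<in> {1..n} \<Longrightarrow> j \<noteq> 1 \<Longrightarrow>
     mixed_rel k n g (xT @ \<zeta> j @ word_inv xT)
       (word_conj (\<zeta> j) (word_comm (word_inv x) (word_inv (\<zeta> 1))))"
| "i \<in> {1..g} \<Longrightarrow> (xT, x) \<in> {(aT i, a i), (bT i, b i)} \<Longrightarrow> 1 \<in> {1..n} \<Longrightarrow>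
     mixed_rel k n g (xT @ x @ word_inv xT) (word_inv (\<zeta> 1) @ x @ \<zeta> 1)"
| "i \<in> {1..g} \<Longrightarrow> (xT, x) \<in> {(aT i, a i), (bT i, b i)} \<Longrightarrow> 1 \<in> {1..n} \<Longrightarrow>
     j \<in> {1..g} \<Longrightarrow> d \<in> {a j, b j} \<Longrightarrow> j < i \<Longrightarrow>
     mixed_rel k n g (xT @ d @ word_inv xT)
       (word_conj d (word_comm (word_inv x) (word_inv (\<zeta> 1))))"
| "i \<in> {1..g} \<Longrightarrow> xT \<in> {aT i, bT i} \<Longrightarrow> j \<in> {1..g} \<Longrightarrow> d \<in> {a j, b j} \<Longrightarrow> i < j \<Longrightarrow>
     mixed_rel k n g (xT @ d @ word_inv xT) d"
| "i \<in> {1..g} \<Longrightarrow> 1 \<in> {1..n} \<Longrightarrow> mixed_rel k n g (aT i @ b i @ word_inv (aT i)) (b i @ \<zeta> 1)"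
| "i \<in> {1..g} \<Longrightarrow> 1 \<in> {1..n} \<Longrightarrow> mixed_rel k n g (bT i @ a i @ word_inv (bT i))
     (word_inv (\<zeta> 1) @ a i @ word_comm (word_inv (b i)) (word_inv (\<zeta> 1)))"

end


section \<open>Lower central series and centre\<close>

text \<open>Indexed from 1, as usual; the value at 0 is irrelevant.\<close>

fun lower_central :: "('g, 'm) monoid_scheme \<Rightarrow> nat \<Rightarrow> 'g set" where
  "lower_central G 0 = carrier G"
| "lower_central G (Suc 0) = carrier G"
| "lower_central G (Suc (Suc i)) =
     generate G (\<Union>x\<in>carrier G. \<Union>y\<in>lower_central G (Suc i).
       {x \<otimes>\<^bsub>G\<^esub> y \<otimes>\<^bsub>G\<^esub> inv\<^bsub>G\<^esub> x \<otimes>\<^bsub>G\<^esub> inv\<^bsub>G\<^esub> y})"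

definition group_centre :: "('g, 'm) monoid_scheme \<Rightarrow> 'g set" where
  "group_centre G = {z \<in> carrier G. \<forall>x\<in>carrier G. z \<otimes>\<^bsub>G\<^esub> x = x \<otimes>\<^bsub>G\<^esub> z}"

definition factors_through ::
    "('g, 'm) monoid_scheme \<Rightarrow> ('q, 'p) monoid_scheme \<Rightarrow> ('h, 'r) monoid_scheme \<Rightarrow>
     ('g \<Rightarrow> 'h) \<Rightarrow> ('g \<Rightarrow> 'q) \<Rightarrow> bool" where
  "factors_through G Q H f p \<longleftrightarrow> (\<exists>h\<in>hom Q H. \<forall>x\<in>carrier G. f x = h (p x))"

end

theory Submission
  imports Defs "HOL-Algebra.FiniteProduct" "HOL-Library.Function_Algebras"
begin

text \<open>
  In any quotient of \<open>B\<close> of nilpotency class at most two, the braid relation forces all \<open>\<sigma>\<^sub>i\<close> to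
  coincide, and likewise all \<open>\<sigma>\<^sub>i~\<close>. Conversely, once they coincide (with values \<open>\<sigma>\<close> and \<open>\<sigma>~\<close>),
  the remaining relations collapse: all \<open>\<zeta>\<^sub>i\<close> have the same value \<open>\<zeta>\<close>, the elements
  \<open>\<sigma>, \<sigma>~, \<zeta>\<close> are central, and the only nontrivial commutators of generators are
  \<open>[a\<^sub>i, b\<^sub>i] = \<sigma>\<^sup>2\<close>, \<open>[a\<^sub>i~, b\<^sub>i~] = \<sigma>~\<^sup>2\<close> and \<open>[a\<^sub>i~, b\<^sub>i] = [a\<^sub>i, b\<^sub>i~] = \<zeta>\<close>. So the quotient has
  class at most two, which gives (i). These commutators define a Heisenberg-like central extension
  of \<open>\<int>\<close>-valued functions on the handle generators by \<open>\<int>\<^sup>3\<close>, onto which \<open>B\<close> maps; it shows that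
  \<open>\<sigma>, \<sigma>~, \<zeta>\<close> are independent modulo \<open>\<Gamma>\<^sub>3\<close> and, its commutator form being nondegenerate, that
  they generate the centre. The injectivity criteria hold because a nontrivial normal subgroup of a
  group of class two meets the centre.
\<close>

section \<open>Words\<close>

lemma word_eval_Nil [simp]: "word_eval G \<gamma> [] = \<one>\<^bsub>G\<^esub>"
  by (simp add: word_eval_def)

lemma word_eval_Cons [simp]:
  "word_eval G \<gamma> ((x, b) # w) = (if b then \<gamma> x else inv\<^bsub>G\<^esub> \<gamma> x) \<otimes>\<^bsub>G\<^esub> word_eval G \<gamma> w"
  by (simp add: word_eval_def)

lemma word_inv_Nil [simp]: "word_inv [] = []"
  by (simp add: word_inv_def)

lemma word_inv_Cons [simp]: "word_inv ((x, b) # w) = word_inv w @ [(x, \<not> b)]"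
  by (simp add: word_inv_def)

context group
begin

lemma word_eval_closed:
  assumes "\<gamma> ` X \<subseteq> carrier G" "w \<in> lists (X \<times> UNIV)"
  shows "word_eval G \<gamma> w \<in> carrier G"
  using assms(2,1) by (induction w rule: lists.induct) (auto simp: image_subset_iff)

lemma word_eval_append:
  assumes "\<gamma> ` X \<subseteq> carrier G" "u \<in> lists (X \<times> UNIV)" "v \<in> lists (X \<times> UNIV)"
  shows "word_eval G \<gamma> (u @ v) = word_eval G \<gamma> u \<otimes> word_eval G \<gamma> v"
  using assms(2)
proof (induction u rule: lists.induct)
  case Nil
  then show ?case using word_eval_closed[OF assms(1,3)] by simp
next
  case (Cons a l)
  then show ?case using assms(1) word_eval_closed[OF assms(1,3)] word_eval_closed[OF assms(1), of l]
    by (cases a) (auto simp: image_subset_iff m_assoc)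
qed

lemma word_eval_append_total:
  assumes "\<And>x. \<gamma> x \<in> carrier G"
  shows "word_eval G \<gamma> (u @ v) = word_eval G \<gamma> u \<otimes> word_eval G \<gamma> v"
  using word_eval_append[of \<gamma> UNIV u v] assms by auto

lemma generate_word_eval:
  assumes "\<gamma> ` X \<subseteq> carrier G" "h \<in> generate G (\<gamma> ` X)"
  obtains w where "w \<in> lists (X \<times> UNIV)" "h = word_eval G \<gamma> w"
proof -
  have "\<exists>w\<in>lists (X \<times> UNIV). h = word_eval G \<gamma> w"
    using assms(2)
  proof induction
    case one
    then show ?case by (intro bexI[of _ "[]"]) auto
  next
    case (incl h)
    then obtain x where "x \<in> X" "h = \<gamma> x" by auto
    then show ?case using assms(1) by (intro bexI[of _ "[(x, True)]"]) auto
  next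
    case (inv h)
    then obtain x where "x \<in> X" "h = \<gamma> x" by auto
    then show ?case using assms(1) by (intro bexI[of _ "[(x, False)]"]) auto
  next
    case (eng h1 h2)
    then obtain u v where "u \<in> lists (X \<times> UNIV)" "h1 = word_eval G \<gamma> u"
      "v \<in> lists (X \<times> UNIV)" "h2 = word_eval G \<gamma> v" by blast
    then show ?case using word_eval_append[OF assms(1), of u v]
      by (intro bexI[of _ "u @ v"]) auto
  qed
  then show thesis using that by blast
qed

text \<open>A derivation in \<open>word_eq\<close> may pass through words with letters outside
  \<open>X\<close>, because \<open>refl\<close> admits arbitrary words. Hence
  \<open>\<gamma>\<close> has to take values in the carrier on every letter.\<close>

lemma word_eval_word_eq:
  assumes eq: "word_eq X R u v" and \<gamma>: "\<And>x. \<gamma> x \<in> carrier G"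
    and R: "\<And>u v. R u v \<Longrightarrow> word_eval G \<gamma> u = word_eval G \<gamma> v"
  shows "word_eval G \<gamma> u = word_eval G \<gamma> v"
  using eq
proof induction
  case (cancel x b)
  then show ?case using \<gamma>[of x] by auto
qed (use \<gamma> R in \<open>auto simp: word_eval_append_total\<close>)

end

lemma word_eval_cong:
  "w \<in> lists (X \<times> UNIV) \<Longrightarrow> (\<And>x. x \<in> X \<Longrightarrow> \<gamma> x = \<delta> x) \<Longrightarrow> word_eval G \<gamma> w = word_eval G \<delta> w"
  by (induction w rule: lists.induct) auto

lemma (in group_hom) hom_word_eval:
  assumes "\<gamma> ` X \<subseteq> carrier G" "w \<in> lists (X \<times> UNIV)"
  shows "h (word_eval G \<gamma> w) = word_eval H (h \<circ> \<gamma>) w"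
  using assms(2)
proof (induction w rule: lists.induct)
  case (Cons a l)
  then show ?case using assms(1) G.word_eval_closed[OF assms(1), of l]
    by (cases a) (auto simp: image_subset_iff)
qed simp

text \<open>Serves to extend a generator map by the identity outside \<open>X\<close>, so that it
  becomes total in the carrier.\<close>

lemma has_presentation_cong:
  assumes "has_presentation G \<gamma> X R" "\<And>x. x \<in> X \<Longrightarrow> \<gamma> x = \<delta> x"
  shows "has_presentation G \<delta> X R"
proof -
  have "\<gamma> ` X = \<delta> ` X" using assms(2) by (intro image_cong) auto
  moreover have "word_eval G \<gamma> w = word_eval G \<delta> w" if "w \<in> lists (X \<times> UNIV)" for w
    using that assms(2) by (rule word_eval_cong)
  ultimately show ?thesis using assms(1) by (simp add: has_presentation_def)
qed

text \<open>Requiring \<open>\<kappa>\<close> to be total in \<open>K\<close> avoids any condition on the letters of the relators.\<close>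

lemma has_presentation_hom:
  assumes P: "has_presentation G \<gamma> X R" and K: "group K"
    and \<kappa>: "\<And>x. \<kappa> x \<in> carrier K"
    and R: "\<And>u v. R u v \<Longrightarrow> word_eval K \<kappa> u = word_eval K \<kappa> v"
  obtains \<phi> where "\<phi> \<in> hom G K" "\<And>x. x \<in> X \<Longrightarrow> \<phi> (\<gamma> x) = \<kappa> x"
proof -
  interpret K: group K by (rule K)
  interpret G: group G using P by (simp add: has_presentation_def)
  have \<gamma>: "\<gamma> ` X \<subseteq> carrier G" and gen: "generate G (\<gamma> ` X) = carrier G"
    and eq: "\<And>u v. u \<in> lists (X \<times> UNIV) \<Longrightarrow> v \<in> lists (X \<times> UNIV) \<Longrightarrow>
      word_eval G \<gamma> u = word_eval G \<gamma> v \<Longrightarrow> word_eq X R u v"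
    using P by (auto simp: has_presentation_def)
  \<comment> \<open>\<open>W h\<close> is some word over \<open>X\<close> representing
    \<open>h\<close>; its value in \<open>K\<close> will be the image of \<open>h\<close>.\<close>
  define W where "W h = (SOME w. w \<in> lists (X \<times> UNIV) \<and> word_eval G \<gamma> w = h)" for h
  have W: "W h \<in> lists (X \<times> UNIV)" "word_eval G \<gamma> (W h) = h" if "h \<in> carrier G" for h
  proof -
    have "\<exists>w. w \<in> lists (X \<times> UNIV) \<and> word_eval G \<gamma> w = h"
      using G.generate_word_eval[OF \<gamma>, of h] that gen by metis
    from someI_ex[OF this] show "W h \<in> lists (X \<times> UNIV)" "word_eval G \<gamma> (W h) = h"
      by (auto simp: W_def)
  qed
  \<comment> \<open>Independence of the choice: two words with the same value in \<open>G\<close>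
    are related by \<open>word_eq\<close>, and the relations hold in \<open>K\<close>.\<close>
  have phi: "word_eval K \<kappa> (W (word_eval G \<gamma> w)) = word_eval K \<kappa> w"
    if w: "w \<in> lists (X \<times> UNIV)" for w
  proof (rule K.word_eval_word_eq[OF _ \<kappa> R])
    have "word_eval G \<gamma> w \<in> carrier G" using w G.word_eval_closed[OF \<gamma>] by blast
    with w show "word_eq X R (W (word_eval G \<gamma> w)) w" by (intro eq W) auto
  qed
  have \<kappa>': "\<kappa> ` X \<subseteq> carrier K" using \<kappa> by auto
  show thesis
  proof (rule that[of "\<lambda>h. word_eval K \<kappa> (W h)"])
    show "(\<lambda>h. word_eval K \<kappa> (W h)) \<in> hom G K"
    proof (rule homI)
      fix x assume "x \<in> carrier G"
      then show "word_eval K \<kappa> (W x) \<in> carrier K"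
        by (intro K.word_eval_closed[OF \<kappa>'] W)
    next
      fix x y assume x: "x \<in> carrier G" and y: "y \<in> carrier G"
      have "word_eval G \<gamma> (W x @ W y) = x \<otimes>\<^bsub>G\<^esub> y"
        using W x y by (simp add: G.word_eval_append[OF \<gamma>])
      then show "word_eval K \<kappa> (W (x \<otimes>\<^bsub>G\<^esub> y)) = word_eval K \<kappa> (W x) \<otimes>\<^bsub>K\<^esub> word_eval K \<kappa> (W y)"
        using phi[of "W x @ W y"] W x y by (simp add: K.word_eval_append_total[OF \<kappa>])
    qed
  next
    fix x assume "x \<in> X"
    then show "word_eval K \<kappa> (W (\<gamma> x)) = \<kappa> x"
      using phi[of "[(x, True)]"] \<gamma> \<kappa>[of x] by auto
  qed
qed


section \<open>Groups of nilpotency class two\<close>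

abbreviation group_comm :: "('g, 'm) monoid_scheme \<Rightarrow> 'g \<Rightarrow> 'g \<Rightarrow> 'g" where
  "group_comm G x y \<equiv> x \<otimes>\<^bsub>G\<^esub> y \<otimes>\<^bsub>G\<^esub> inv\<^bsub>G\<^esub> x \<otimes>\<^bsub>G\<^esub> inv\<^bsub>G\<^esub> y"

definition class_two :: "('g, 'm) monoid_scheme \<Rightarrow> bool" where
  "class_two G \<longleftrightarrow> (\<forall>x\<in>carrier G. \<forall>y\<in>carrier G. group_comm G x y \<in> group_centre G)"

lemma lower_central_2:
  "lower_central G 2 = generate G (\<Union>x\<in>carrier G. \<Union>y\<in>carrier G. {group_comm G x y})"
  by (simp add: numeral_2_eq_2)

lemma lower_central_3:
  "lower_central G 3 = generate G (\<Union>x\<in>carrier G. \<Union>y\<in>lower_central G 2. {group_comm G x y})"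
  by (simp add: numeral_3_eq_3 numeral_2_eq_2)

context group
begin

lemma conj_comm:
  assumes "a \<in> carrier G" "x \<in> carrier G" "y \<in> carrier G"
  shows "a \<otimes> group_comm G x y \<otimes> inv a = group_comm G (a \<otimes> x \<otimes> inv a) (a \<otimes> y \<otimes> inv a)"
proof -
  have c: "inv a \<otimes> (a \<otimes> z) = z" if "z \<in> carrier G" for z
    using that assms by (simp add: m_assoc[symmetric])
  show ?thesis using assms by (simp add: m_assoc inv_mult_group c)
qed

lemma comm_commute:
  assumes "x \<in> carrier G" "y \<in> carrier G"
  shows "x \<otimes> y = group_comm G x y \<otimes> (y \<otimes> x)"
proof -
  have c: "inv a \<otimes> (a \<otimes> z) = z" if "z \<in> carrier G" "a \<in> carrier G" for a z
    using that by (simp add: m_assoc[symmetric])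
  show ?thesis using assms by (simp add: m_assoc c)
qed

lemma comm_eq_one_iff:
  assumes "x \<in> carrier G" "y \<in> carrier G"
  shows "group_comm G x y = \<one> \<longleftrightarrow> x \<otimes> y = y \<otimes> x"
proof
  assume "group_comm G x y = \<one>"
  then show "x \<otimes> y = y \<otimes> x" using comm_commute[OF assms] assms by simp
next
  assume "x \<otimes> y = y \<otimes> x"
  then have "group_comm G x y = y \<otimes> (x \<otimes> inv x) \<otimes> inv y" using assms by (simp only: m_assoc m_closed inv_closed)
  then show "group_comm G x y = \<one>" using assms by simp
qed

lemma inv_commute:
  assumes "x \<in> carrier G" "y \<in> carrier G" "x \<otimes> y = y \<otimes> x"
  shows "x \<otimes> inv y = inv y \<otimes> x"
proof -
  have "x \<otimes> inv y = inv y \<otimes> (y \<otimes> x) \<otimes> inv y"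
    using assms(1,2) by (simp add: m_assoc[symmetric])
  also have "\<dots> = inv y \<otimes> (x \<otimes> y) \<otimes> inv y" using assms(3) by simp
  also have "\<dots> = inv y \<otimes> x" using assms(1,2) by (simp add: m_assoc)
  finally show ?thesis .
qed

lemma inv_group_comm:
  assumes "x \<in> carrier G" "y \<in> carrier G"
  shows "inv (group_comm G x y) = group_comm G y x"
  using assms by (simp add: m_assoc inv_mult_group)

text \<open>A conjugate of a commutator is the commutator of the conjugates
  (\<open>conj_comm\<close>), so normality of one term makes the generating set of the next one
  invariant under conjugation.\<close>

lemma lower_central_Suc_normal: "lower_central G (Suc i) \<lhd> G"
proof (induction i)
  case 0
  show ?case by (simp add: normal_self)
next
  case (Suc i)
  then interpret L: normal "lower_central G (Suc i)" G .
  show ?case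
  proof (simp only: lower_central.simps, rule normal_generateI)
    show "(\<Union>x\<in>carrier G. \<Union>y\<in>lower_central G (Suc i). {group_comm G x y}) \<subseteq> carrier G"
      using L.subset by auto
  next
    fix h a assume h: "h \<in> (\<Union>x\<in>carrier G. \<Union>y\<in>lower_central G (Suc i). {group_comm G x y})"
      and a: "a \<in> carrier G"
    then obtain x y where xy: "x \<in> carrier G" "y \<in> lower_central G (Suc i)" "h = group_comm G x y"
      by blast
    then have "y \<in> carrier G" using L.subset by auto
    then have "a \<otimes> h \<otimes> inv a = group_comm G (a \<otimes> x \<otimes> inv a) (a \<otimes> y \<otimes> inv a)"
      using conj_comm a xy by simp
    moreover have "a \<otimes> y \<otimes> inv a \<in> lower_central G (Suc i)"
      using L.inv_op_closed2 a xy by blast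
    ultimately show "a \<otimes> h \<otimes> inv a \<in>
        (\<Union>x\<in>carrier G. \<Union>y\<in>lower_central G (Suc i). {group_comm G x y})"
      using a xy(1) by (intro UN_I[of "a \<otimes> x \<otimes> inv a"] UN_I[of "a \<otimes> y \<otimes> inv a"]) auto
  qed
qed

lemma lower_central_normal: "lower_central G 2 \<lhd> G" "lower_central G 3 \<lhd> G"
  using lower_central_Suc_normal[of 1] lower_central_Suc_normal[of 2]
  by (simp_all add: numeral_2_eq_2 numeral_3_eq_3)

lemma centre_subgroup: "subgroup (group_centre G) G"
proof (rule subgroupI)
  show "group_centre G \<subseteq> carrier G" by (auto simp: group_centre_def)
  show "group_centre G \<noteq> {}" by (auto simp: group_centre_def)
  show "inv a \<in> group_centre G" if "a \<in> group_centre G" for a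
    using that inv_commute[of _ a] by (simp add: group_centre_def)
  show "a \<otimes> b \<in> group_centre G" if "a \<in> group_centre G" "b \<in> group_centre G" for a b
  proof -
    have a: "a \<in> carrier G" "\<And>x. x \<in> carrier G \<Longrightarrow> a \<otimes> x = x \<otimes> a"
      and b: "b \<in> carrier G" "\<And>x. x \<in> carrier G \<Longrightarrow> b \<otimes> x = x \<otimes> b"
      using that by (auto simp: group_centre_def)
    have "a \<otimes> b \<otimes> x = x \<otimes> (a \<otimes> b)" if x: "x \<in> carrier G" for x
    proof -
      have "a \<otimes> b \<otimes> x = (a \<otimes> x) \<otimes> b" using a(1) b x by (simp add: m_assoc)
      also have "\<dots> = x \<otimes> (a \<otimes> b)" using a b(1) x by (simp add: m_assoc)
      finally show ?thesis .
    qed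
    moreover have "a \<otimes> b \<in> carrier G" using a(1) b(1) by simp
    ultimately show ?thesis unfolding group_centre_def by blast
  qed
qed

lemma commute_generate:
  assumes S: "S \<subseteq> carrier G" and x: "x \<in> carrier G" and "\<And>y. y \<in> S \<Longrightarrow> x \<otimes> y = y \<otimes> x"
    and h: "h \<in> generate G S"
  shows "x \<otimes> h = h \<otimes> x"
  using h
proof induction
  case (inv h)
  then have "h \<in> carrier G" "x \<otimes> h = h \<otimes> x" using assms by auto
  then show ?case using x inv_commute by blast
next
  case (eng h1 h2)
  then have "h1 \<in> carrier G" "h2 \<in> carrier G" using generate_in_carrier[OF S] by auto
  with eng x show ?case by (metis m_assoc)
qed (use assms in auto)

lemma comm_group_generate:
  assumes S: "S \<subseteq> carrier G" and gen: "generate G S = carrier G"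
    and c: "\<And>x y. x \<in> S \<Longrightarrow> y \<in> S \<Longrightarrow> x \<otimes> y = y \<otimes> x"
  shows "comm_group G"
proof (rule group_comm_groupI)
  fix x y assume xy: "x \<in> carrier G" "y \<in> carrier G"
  have *: "u \<otimes> y = y \<otimes> u" if "u \<in> S" for u
    using commute_generate[OF S _ _ , of u y] c that xy gen S by auto
  show "x \<otimes> y = y \<otimes> x"
    using commute_generate[OF S xy(2), of x] * xy gen by auto
qed

lemma centre_generateI:
  assumes "S \<subseteq> carrier G" "generate G S = carrier G" "x \<in> carrier G"
    "\<And>y. y \<in> S \<Longrightarrow> x \<otimes> y = y \<otimes> x"
  shows "x \<in> group_centre G"
  using commute_generate[OF assms(1,3,4)] assms(2,3) by (auto simp: group_centre_def)

text \<open>Let \<open>c\<close> be the commutator of \<open>x y\<close> and \<open>x\<close>. The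
  braid relation \<open>(x y) x = y (x y)\<close> becomes \<open>y (x y) = c x (x y)\<close>, so
  \<open>y = c x\<close> with \<open>c\<close> central. Putting this back into the braid relation
  gives \<open>c x^3 = c^2 x^3\<close>, whence \<open>c = 1\<close>.\<close>

lemma class_two_braid:
  assumes c2: "class_two G" and x: "x \<in> carrier G" and y: "y \<in> carrier G"
    and braid: "x \<otimes> (y \<otimes> x) = y \<otimes> (x \<otimes> y)"
  shows "x = y"
proof -
  define c where "c = group_comm G (x \<otimes> y) x"
  have c: "c \<in> carrier G" "\<And>z. z \<in> carrier G \<Longrightarrow> c \<otimes> z = z \<otimes> c"
    using c2 x y unfolding class_two_def c_def by (auto simp: group_centre_def)
  have "(x \<otimes> y) \<otimes> x = c \<otimes> (x \<otimes> (x \<otimes> y))"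
    unfolding c_def by (rule comm_commute) (use x y in auto)
  then have "y \<otimes> (x \<otimes> y) = (c \<otimes> x) \<otimes> (x \<otimes> y)" using braid x y c(1) by (simp add: m_assoc)
  then have yc: "y = c \<otimes> x" using x y c(1) by simp
  have "x \<otimes> (c \<otimes> x \<otimes> x) = c \<otimes> (x \<otimes> (x \<otimes> x))"
  proof -
    have "x \<otimes> (c \<otimes> x \<otimes> x) = (x \<otimes> c) \<otimes> (x \<otimes> x)" using x c(1) by (simp add: m_assoc)
    also have "\<dots> = (c \<otimes> x) \<otimes> (x \<otimes> x)" using c(2)[of x] x by simp
    finally show ?thesis using x c(1) by (simp add: m_assoc)
  qed
  moreover have "c \<otimes> x \<otimes> (x \<otimes> (c \<otimes> x)) = c \<otimes> (c \<otimes> (x \<otimes> (x \<otimes> x)))"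
  proof -
    have "c \<otimes> x \<otimes> (x \<otimes> (c \<otimes> x)) = c \<otimes> (((x \<otimes> x) \<otimes> c) \<otimes> x)"
      using x c(1) by (simp add: m_assoc)
    also have "\<dots> = c \<otimes> ((c \<otimes> (x \<otimes> x)) \<otimes> x)" using c(2)[of "x \<otimes> x"] x by simp
    finally show ?thesis using x c(1) by (simp add: m_assoc)
  qed
  ultimately have "c \<otimes> (x \<otimes> (x \<otimes> x)) = c \<otimes> (c \<otimes> (x \<otimes> (x \<otimes> x)))"
    using braid yc by simp
  then have "x \<otimes> (x \<otimes> x) = c \<otimes> (x \<otimes> (x \<otimes> x))" using x c(1) by simp
  then have "c = \<one>" using x c(1) by (simp add: r_cancel_one')
  then show ?thesis using yc x by simp
qed

end


section \<open>Quotients of the mixed braid groups\<close>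

text \<open>An arbitrary quotient of the presented group; the genus is left free so that
  \<open>g = 0\<close> covers the disc. As in \<open>has_presentation_hom\<close>,
  \<open>\<kappa>\<close> is total.\<close>

locale mixed_quotient = group K for K (structure) +
  fixes \<kappa> :: "mixed_gen \<Rightarrow> 'a" and k n g :: nat
  assumes k3: "3 \<le> k" and n3: "3 \<le> n"
    and closed [simp]: "\<kappa> x \<in> carrier K"
    and gen: "generate K (\<kappa> ` mixed_gens k n g) = carrier K"
    and rel: "mixed_rel k n g u v \<Longrightarrow> word_eval K \<kappa> u = word_eval K \<kappa> v"
begin

lemma braid_Sig:
  assumes "class_two K" "i \<in> {1..<k}" "i + 1 \<in> {1..<k}"
  shows "\<kappa> (Sig (i + 1)) = \<kappa> (Sig i)"
proof (rule class_two_braid[OF assms(1), symmetric])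
qed (use rel[OF mixed_rel.intros(1)[OF surface_rel.intros(2)[OF assms(2,3)]]] in auto)

lemma braid_SigT:
  assumes "class_two K" "i \<in> {1..<n}" "i + 1 \<in> {1..<n}"
  shows "\<kappa> (SigT (i + 1)) = \<kappa> (SigT i)"
proof (rule class_two_braid[OF assms(1), symmetric])
qed (use rel[OF mixed_rel.intros(6)[OF surface_rel.intros(2)[OF assms(2,3)]]] in auto)

end

lemma eq_first:
  assumes "\<And>i. 1 \<le> i \<Longrightarrow> i + 1 < m \<Longrightarrow> f (i + 1) = f i" and "i \<in> {1..<m::nat}"
  shows "f i = f 1"
proof -
  have "1 \<le> i" using assms(2) by simp
  then have "i < m \<longrightarrow> f i = f 1"
    by (induction i rule: dec_induct) (use assms(1) in auto)
  then show ?thesis using assms(2) by simp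
qed

section \<open>The relations once each family of braid generators is constant\<close>

locale mixed_quotient_const = mixed_quotient +
  assumes Sig_eq: "i \<in> {1..<k} \<Longrightarrow> \<kappa> (Sig i) = \<kappa> (Sig 1)"
    and SigT_eq: "i \<in> {1..<n} \<Longrightarrow> \<kappa> (SigT i) = \<kappa> (SigT 1)"
begin

lemma conj_eq:
  assumes "x \<in> carrier K" "y \<in> carrier K" "x \<otimes> (y \<otimes> inv x) = w"
  shows "x \<otimes> y = w \<otimes> x"
  using assms by (auto simp: m_assoc)

abbreviation "s \<equiv> \<kappa> (Sig 1)"
abbreviation "t \<equiv> \<kappa> (SigT 1)"
abbreviation "z \<equiv> \<kappa> (Zet 1)"

lemma inv_mult_cancel [simp]: "x \<in> carrier K \<Longrightarrow> y \<in> carrier K \<Longrightarrow> inv x \<otimes> (x \<otimes> y) = y"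
  "x \<in> carrier K \<Longrightarrow> y \<in> carrier K \<Longrightarrow> x \<otimes> (inv x \<otimes> y) = y"
  by (simp_all add: m_assoc[symmetric])

lemma index_bounds: "2 \<in> {1..<k}" "2 \<noteq> (1::nat)" "1 \<in> {1..<k}" "2 \<in> {1..<n}" "1 \<in> {1..<n}" "1 \<in> {1..n}"
  using k3 n3 by auto

text \<open>The commutation relation is available only for indices other than 1. It is applied at
  index 2, which exists because \<open>3 \<le> k\<close>, and \<open>Sig 2\<close> has the same
  value as \<open>Sig 1\<close>. The same device is used for the handle generators.\<close>

lemma Sig_Zet: assumes "l \<in> {1..n}" shows "s \<otimes> \<kappa> (Zet l) = \<kappa> (Zet l) \<otimes> s"
  using rel[OF mixed_rel.intros(2)[OF assms index_bounds(1,2)]] Sig_eq[OF index_bounds(1)] by simp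

lemma Sig_GenA: assumes "j \<in> {1..g}" shows "s \<otimes> \<kappa> (GenA j) = \<kappa> (GenA j) \<otimes> s"
  using rel[OF mixed_rel.intros(1)[OF surface_rel.intros(3)[OF index_bounds(1,2) assms insertI1]]]
    Sig_eq[OF index_bounds(1)] by simp

lemma Sig_GenB: assumes "j \<in> {1..g}" shows "s \<otimes> \<kappa> (GenB j) = \<kappa> (GenB j) \<otimes> s"
  using rel[OF mixed_rel.intros(1)[OF surface_rel.intros(3)[OF index_bounds(1,2) assms insertI2[OF singletonI]]]]
    Sig_eq[OF index_bounds(1)] by simp

lemma SigT_GenAT: assumes "j \<in> {1..g}" shows "t \<otimes> \<kappa> (GenAT j) = \<kappa> (GenAT j) \<otimes> t"
  using rel[OF mixed_rel.intros(6)[OF surface_rel.intros(3)[OF index_bounds(4,2) assms insertI1]]]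
    SigT_eq[OF index_bounds(4)] by simp

lemma SigT_GenBT: assumes "j \<in> {1..g}" shows "t \<otimes> \<kappa> (GenBT j) = \<kappa> (GenBT j) \<otimes> t"
  using rel[OF mixed_rel.intros(6)[OF surface_rel.intros(3)[OF index_bounds(4,2) assms insertI2[OF singletonI]]]]
    SigT_eq[OF index_bounds(4)] by simp

lemma SigT_Sig: "t \<otimes> s = s \<otimes> t"
  using rel[OF mixed_rel.intros(7)[OF index_bounds(5,3)]] by simp

lemma Sig_GenAT: assumes "j \<in> {1..g}" shows "s \<otimes> \<kappa> (GenAT j) = \<kappa> (GenAT j) \<otimes> s"
  using rel[OF mixed_rel.intros(8)[OF assms insertI1 index_bounds(3)]] by simp

lemma Sig_GenBT: assumes "j \<in> {1..g}" shows "s \<otimes> \<kappa> (GenBT j) = \<kappa> (GenBT j) \<otimes> s"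
  using rel[OF mixed_rel.intros(8)[OF assms insertI2[OF singletonI] index_bounds(3)]] by simp

lemma SigT_GenA: assumes "j \<in> {1..g}" shows "t \<otimes> \<kappa> (GenA j) = \<kappa> (GenA j) \<otimes> t"
  using rel[OF mixed_rel.intros(9)[OF index_bounds(5) assms insertI1]] by simp

lemma SigT_GenB: assumes "j \<in> {1..g}" shows "t \<otimes> \<kappa> (GenB j) = \<kappa> (GenB j) \<otimes> t"
  using rel[OF mixed_rel.intros(9)[OF index_bounds(5) assms insertI2[OF singletonI]]] by simp

lemma Zet_step: assumes "i \<in> {1..<n}" shows "t \<otimes> \<kappa> (Zet (i + 1)) = \<kappa> (Zet i) \<otimes> t"
  using rel[OF mixed_rel.intros(10)[OF assms]] SigT_eq[OF assms] by (intro conj_eq) auto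

lemma SigT_Zet_far:
  assumes "i \<in> {1..<n}" "j \<in> {1..n}" "j \<noteq> i" "j \<noteq> i + 1"
  shows "t \<otimes> \<kappa> (Zet j) = \<kappa> (Zet j) \<otimes> t"
  using rel[OF mixed_rel.intros(12)[OF assms]] SigT_eq[OF assms(1)] by (intro conj_eq) auto

text \<open>For \<open>i > 1\<close> the letter \<open>Zet (i + 1)\<close> is far from
  \<open>SigT 1\<close>. For \<open>n = 3\<close> no such relation reaches \<open>Zet 2\<close>; it
  is identified with \<open>Zet 3\<close> instead, since \<open>t\<close> commutes with the value of
  \<open>Zet 3\<close> by index 1 and conjugates it to that of \<open>Zet 2\<close> by index
  2.\<close>

lemma SigT_Zet_Suc: "i \<in> {1..<n} \<Longrightarrow> t \<otimes> \<kappa> (Zet (i + 1)) = \<kappa> (Zet (i + 1)) \<otimes> t"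
proof (cases "i = 1")
  case True
  have "t \<otimes> \<kappa> (Zet 3) = \<kappa> (Zet 3) \<otimes> t" using SigT_Zet_far[of 1 3] n3 by auto
  moreover have "t \<otimes> \<kappa> (Zet 3) = \<kappa> (Zet 2) \<otimes> t" using Zet_step[of 2] n3 by auto
  ultimately have "\<kappa> (Zet 3) = \<kappa> (Zet 2)" by simp
  with \<open>t \<otimes> \<kappa> (Zet 3) = \<kappa> (Zet 3) \<otimes> t\<close> True show ?thesis by (simp add: numeral_2_eq_2)
next
  case False
  then show "i \<in> {1..<n} \<Longrightarrow> ?thesis" using SigT_Zet_far[of 1 "i + 1"] n3 by auto
qed

lemma Zet_eq: "i \<in> {1..n} \<Longrightarrow> \<kappa> (Zet i) = z"
\<comment> \<open>\<open>eq_first\<close> uses a half-open range, whereas the indices of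
  \<open>Zet\<close> run up to \<open>n\<close> inclusive.\<close>
proof (rule eq_first[where m = "n + 1"])
  fix i assume i: "1 \<le> i" "i + 1 < n + 1"
  then have "\<kappa> (Zet (i + 1)) \<otimes> t = \<kappa> (Zet i) \<otimes> t"
    using Zet_step[of i] SigT_Zet_Suc[of i] by simp
  then show "\<kappa> (Zet (i + 1)) = \<kappa> (Zet i)" by simp
qed auto

lemma SigT_Zet: "t \<otimes> z = z \<otimes> t"
  using SigT_Zet_far[of 2 1] n3 by auto

text \<open>Meant as rewrite rules for right-associated products: conjugation by a commuting element
  drops out, also in front of a tail \<open>w\<close>. Most relators below collapse in this
  way.\<close>

lemma conj_cancel:
  assumes "x \<in> carrier K" "y \<in> carrier K" "x \<otimes> y = y \<otimes> x"
  shows "inv x \<otimes> (y \<otimes> x) = y" "w \<in> carrier K \<Longrightarrow> inv x \<otimes> (y \<otimes> (x \<otimes> w)) = y \<otimes> w"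
    "inv x \<otimes> (inv y \<otimes> x) = inv y" "w \<in> carrier K \<Longrightarrow> inv x \<otimes> (inv y \<otimes> (x \<otimes> w)) = inv y \<otimes> w"
proof -
  have *: "inv x \<otimes> (v \<otimes> x) = v \<and> (w \<in> carrier K \<longrightarrow> inv x \<otimes> (v \<otimes> (x \<otimes> w)) = v \<otimes> w)"
    if "v \<in> carrier K" "x \<otimes> v = v \<otimes> x" for v w
  proof -
    have "v \<otimes> (x \<otimes> w) = x \<otimes> (v \<otimes> w)" if "w \<in> carrier K"
      using that assms(1) \<open>v \<in> carrier K\<close> \<open>x \<otimes> v = v \<otimes> x\<close> by (metis m_assoc)
    then show ?thesis using that assms(1) by (simp flip: that(2))
  qed
  show "inv x \<otimes> (y \<otimes> x) = y" "w \<in> carrier K \<Longrightarrow> inv x \<otimes> (y \<otimes> (x \<otimes> w)) = y \<otimes> w"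
    using *[of y] assms by auto
  show "inv x \<otimes> (inv y \<otimes> x) = inv y" "w \<in> carrier K \<Longrightarrow> inv x \<otimes> (inv y \<otimes> (x \<otimes> w)) = inv y \<otimes> w"
    using *[of "inv y"] assms inv_commute[OF assms] by auto
qed

text \<open>The relation concerns the conjugate of \<open>z\<close> by \<open>s\<close>, which is
  \<open>z\<close> itself because the two commute.\<close>

lemma Zet_GenA: assumes "j \<in> {1..g}" shows "z \<otimes> \<kappa> (GenA j) = \<kappa> (GenA j) \<otimes> z"
  using rel[OF mixed_rel.intros(4)[OF index_bounds(6,3) assms insertI1]]
  by (simp add: conj_cancel[OF _ _ Sig_Zet[OF index_bounds(6)], simplified])

lemma Zet_GenB: assumes "j \<in> {1..g}" shows "z \<otimes> \<kappa> (GenB j) = \<kappa> (GenB j) \<otimes> z"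
  using rel[OF mixed_rel.intros(4)[OF index_bounds(6,3) assms insertI2[OF singletonI]]]
  by (simp add: conj_cancel[OF _ _ Sig_Zet[OF index_bounds(6)], simplified])

lemmas Zet_conj = conj_cancel[OF _ _ Zet_GenA, simplified] conj_cancel[OF _ _ Zet_GenB, simplified]

lemma Zet_GenAT: assumes "j \<in> {1..g}" shows "\<kappa> (GenAT j) \<otimes> z = z \<otimes> \<kappa> (GenAT j)"
  using rel[OF mixed_rel.intros(13)[OF assms insertI1 index_bounds(6)]] assms
  by (intro conj_eq) (simp_all add: word_conj_def Zet_conj)

lemma Zet_GenBT: assumes "j \<in> {1..g}" shows "\<kappa> (GenBT j) \<otimes> z = z \<otimes> \<kappa> (GenBT j)"
  using rel[OF mixed_rel.intros(13)[OF assms insertI2[OF singletonI] index_bounds(6)]] assms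
  by (intro conj_eq) (simp_all add: word_conj_def Zet_conj)

text \<open>When \<open>x\<close> commutes with \<open>a\<close> and \<open>b\<close>, the relation
  \<open>a x b = x b x a x\<close> reads \<open>x (a b) = x^3 (b a)\<close>, and one
  \<open>x\<close> cancels.\<close>

lemma handle_comm:
  assumes "i \<in> {1..g}"
  shows "\<kappa> (GenA i) \<otimes> \<kappa> (GenB i) = s \<otimes> s \<otimes> (\<kappa> (GenB i) \<otimes> \<kappa> (GenA i))"
    "\<kappa> (GenAT i) \<otimes> \<kappa> (GenBT i) = t \<otimes> t \<otimes> (\<kappa> (GenBT i) \<otimes> \<kappa> (GenAT i))"
proof -
  have *: "a \<otimes> b = x \<otimes> x \<otimes> (b \<otimes> a)" if c: "x \<in> carrier K" "a \<in> carrier K" "b \<in> carrier K"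
      and xa: "x \<otimes> a = a \<otimes> x" and xb: "x \<otimes> b = b \<otimes> x"
      and eq: "a \<otimes> (x \<otimes> b) = x \<otimes> (b \<otimes> (x \<otimes> (a \<otimes> x)))" for x a b
  proof -
    have "x \<otimes> (a \<otimes> b) = (x \<otimes> a) \<otimes> b" using c by (simp add: m_assoc)
    also have "\<dots> = a \<otimes> (x \<otimes> b)" using c by (simp add: xa m_assoc)
    also have "\<dots> = x \<otimes> ((b \<otimes> x) \<otimes> (a \<otimes> x))" using c eq by (simp add: m_assoc)
    also have "\<dots> = x \<otimes> ((x \<otimes> b) \<otimes> (x \<otimes> a))" by (simp only: xa xb)
    also have "\<dots> = x \<otimes> (x \<otimes> ((b \<otimes> x) \<otimes> a))" using c by (simp add: m_assoc)
    also have "\<dots> = x \<otimes> (x \<otimes> ((x \<otimes> b) \<otimes> a))" by (simp only: xb)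
    finally show ?thesis using c by (simp add: m_assoc)
  qed
  show "\<kappa> (GenA i) \<otimes> \<kappa> (GenB i) = s \<otimes> s \<otimes> (\<kappa> (GenB i) \<otimes> \<kappa> (GenA i))"
    using rel[OF mixed_rel.intros(1)[OF surface_rel.intros(5)[OF index_bounds(3) assms]]]
    by (intro *[OF _ _ _ Sig_GenA[OF assms] Sig_GenB[OF assms]]) auto
  show "\<kappa> (GenAT i) \<otimes> \<kappa> (GenBT i) = t \<otimes> t \<otimes> (\<kappa> (GenBT i) \<otimes> \<kappa> (GenAT i))"
    using rel[OF mixed_rel.intros(6)[OF surface_rel.intros(5)[OF index_bounds(5) assms]]]
    by (intro *[OF _ _ _ SigT_GenAT[OF assms] SigT_GenBT[OF assms]]) auto
qed

lemma handles_commute: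
  assumes "i \<in> {1..g}" "j \<in> {1..g}" "i < j"
  shows "c \<in> {GenA i, GenB i} \<Longrightarrow> d \<in> {GenA j, GenB j} \<Longrightarrow> \<kappa> c \<otimes> \<kappa> d = \<kappa> d \<otimes> \<kappa> c"
    and "c \<in> {GenAT i, GenBT i} \<Longrightarrow> d \<in> {GenAT j, GenBT j} \<Longrightarrow> \<kappa> c \<otimes> \<kappa> d = \<kappa> d \<otimes> \<kappa> c"
proof -
  assume cd: "c \<in> {GenA i, GenB i}" "d \<in> {GenA j, GenB j}"
  then have c: "letter c \<in> {letter (GenA i), letter (GenB i)}"
    and d: "letter d \<in> {letter (GenA j), letter (GenB j)}" by auto
  have "s \<otimes> \<kappa> c = \<kappa> c \<otimes> s" using cd Sig_GenA Sig_GenB assms by auto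
  note [simp] = conj_cancel[OF _ _ this, simplified]
  show "\<kappa> c \<otimes> \<kappa> d = \<kappa> d \<otimes> \<kappa> c"
    using rel[OF mixed_rel.intros(1)[OF surface_rel.intros(6)[OF index_bounds(3) assms c d]]] by simp
next
  assume cd: "c \<in> {GenAT i, GenBT i}" "d \<in> {GenAT j, GenBT j}"
  then have c: "letter c \<in> {letter (GenAT i), letter (GenBT i)}"
    and d: "letter d \<in> {letter (GenAT j), letter (GenBT j)}" by auto
  have "t \<otimes> \<kappa> c = \<kappa> c \<otimes> t" using cd SigT_GenAT SigT_GenBT assms by auto
  note [simp] = conj_cancel[OF _ _ this, simplified]
  show "\<kappa> c \<otimes> \<kappa> d = \<kappa> d \<otimes> \<kappa> c"
    using rel[OF mixed_rel.intros(6)[OF surface_rel.intros(6)[OF index_bounds(5) assms c d]]] by simp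
qed

lemma mixed_handles_commute:
  assumes i: "i \<in> {1..g}" and j: "j \<in> {1..g}" and "i \<noteq> j"
    and c: "c \<in> {GenAT i, GenBT i}" and d: "d \<in> {GenA j, GenB j}"
  shows "\<kappa> c \<otimes> \<kappa> d = \<kappa> d \<otimes> \<kappa> c"
proof (cases "i < j")
  case True
  have c': "letter c \<in> {letter (GenAT i), letter (GenBT i)}"
    and d': "letter d \<in> {letter (GenA j), letter (GenB j)}" using c d by auto
  show ?thesis
    using rel[OF mixed_rel.intros(17)[OF i c' j d' True]] by (intro conj_eq) auto
next
  case False
  then have ji: "j < i" using \<open>i \<noteq> j\<close> by simp
  \<comment> \<open>\<open>x\<close> is the letter \<open>c\<close> with its tilde removed. For
    \<open>j < i\<close> the relation conjugates \<open>d\<close> by the commutator of the inverses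
    of \<open>x\<close> and \<open>Zet 1\<close>, which is trivial here because \<open>z\<close>
    commutes with \<open>\<kappa> x\<close>.\<close>
  define x where "x = (if c = GenAT i then GenA i else GenB i)"
  have "(letter c, letter x) \<in> {(letter (GenAT i), letter (GenA i)), (letter (GenBT i), letter (GenB i))}"
    "letter d \<in> {letter (GenA j), letter (GenB j)}" using c d by (auto simp: x_def)
  then have eq: "word_eval K \<kappa> (letter c @ letter d @ word_inv (letter c)) =
      word_eval K \<kappa> (word_conj (letter d) (word_comm (word_inv (letter x)) (word_inv (letter (Zet 1)))))"
    using rel[OF mixed_rel.intros(16)[OF i _ index_bounds(6) j _ ji]] by blast
  have "z \<otimes> \<kappa> x = \<kappa> x \<otimes> z" using Zet_GenA Zet_GenB i by (auto simp: x_def)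
  note [simp] = conj_cancel[OF _ _ this, simplified]
  show ?thesis
    using eq by (intro conj_eq) (simp_all add: word_conj_def word_comm_def)
qed

lemma same_handle_commute:
  assumes "i \<in> {1..g}"
  shows "\<kappa> (GenAT i) \<otimes> \<kappa> (GenA i) = \<kappa> (GenA i) \<otimes> \<kappa> (GenAT i)"
    "\<kappa> (GenBT i) \<otimes> \<kappa> (GenB i) = \<kappa> (GenB i) \<otimes> \<kappa> (GenBT i)"
proof -
  show "\<kappa> (GenAT i) \<otimes> \<kappa> (GenA i) = \<kappa> (GenA i) \<otimes> \<kappa> (GenAT i)"
    using rel[OF mixed_rel.intros(15)[OF assms insertI1 index_bounds(6)]] assms
    by (intro conj_eq) (simp_all add: Zet_conj)
  show "\<kappa> (GenBT i) \<otimes> \<kappa> (GenB i) = \<kappa> (GenB i) \<otimes> \<kappa> (GenBT i)"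
    using rel[OF mixed_rel.intros(15)[OF assms insertI2[OF singletonI] index_bounds(6)]] assms
    by (intro conj_eq) (simp_all add: Zet_conj)
qed

text \<open>These are the relations in which \<open>z\<close> survives as a commutator. In the
  second one the trailing commutator of the inverses of \<open>GenB i\<close> and
  \<open>Zet 1\<close> vanishes, since \<open>z\<close> commutes with
  \<open>\<kappa> (GenB i)\<close>.\<close>

lemma mixed_handle_comm:
  assumes "i \<in> {1..g}"
  shows "\<kappa> (GenAT i) \<otimes> \<kappa> (GenB i) = z \<otimes> (\<kappa> (GenB i) \<otimes> \<kappa> (GenAT i))"
    "\<kappa> (GenBT i) \<otimes> \<kappa> (GenA i) = inv z \<otimes> (\<kappa> (GenA i) \<otimes> \<kappa> (GenBT i))"
proof -
  have "\<kappa> (GenAT i) \<otimes> \<kappa> (GenB i) = (\<kappa> (GenB i) \<otimes> z) \<otimes> \<kappa> (GenAT i)"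
    using rel[OF mixed_rel.intros(18)[OF assms index_bounds(6)]] by (intro conj_eq) auto
  then show "\<kappa> (GenAT i) \<otimes> \<kappa> (GenB i) = z \<otimes> (\<kappa> (GenB i) \<otimes> \<kappa> (GenAT i))"
    using Zet_GenB[OF assms] by (simp add: m_assoc[symmetric])
  have "\<kappa> (GenBT i) \<otimes> \<kappa> (GenA i) = (inv z \<otimes> \<kappa> (GenA i)) \<otimes> \<kappa> (GenBT i)"
    using rel[OF mixed_rel.intros(19)[OF assms index_bounds(6)]] assms
    by (intro conj_eq) (simp_all add: word_comm_def Zet_conj)
  then show "\<kappa> (GenBT i) \<otimes> \<kappa> (GenA i) = inv z \<otimes> (\<kappa> (GenA i) \<otimes> \<kappa> (GenBT i))"
    by (simp add: m_assoc)
qed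

end


section \<open>Commutators modulo a normal subgroup\<close>

context normal
begin

lemma group_hom_Mod: "group_hom G (G Mod H) ((#>) H)"
  by (simp add: group_hom_def group_hom_axioms_def is_group factorgroup_is_group r_coset_hom_Mod)

lemma rcos_eq_one_iff: "x \<in> carrier G \<Longrightarrow> H #> x = H \<longleftrightarrow> x \<in> H"
  by (metis coset_join1 coset_join2 subgroup_axioms subset)

lemma Mod_generate:
  assumes "S \<subseteq> carrier G" "generate G S = carrier G"
  shows "generate (G Mod H) ((\<lambda>x. H #> x) ` S) = carrier (G Mod H)"
  using group_hom.generate_img[OF group_hom_Mod assms(1)] assms(2) by (simp add: carrier_FactGroup)

lemma comm_mem_iff:
  assumes "x \<in> carrier G" "y \<in> carrier G"
  shows "group_comm G x y \<in> H \<longleftrightarrow>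
    (H #> x) \<otimes>\<^bsub>G Mod H\<^esub> (H #> y) = (H #> y) \<otimes>\<^bsub>G Mod H\<^esub> (H #> x)"
proof -
  interpret q: group_hom G "G Mod H" "(#>) H" by (rule group_hom_Mod)
  have "group_comm G x y \<in> H \<longleftrightarrow> H #> group_comm G x y = \<one>\<^bsub>G Mod H\<^esub>"
    using rcos_eq_one_iff[of "group_comm G x y"] assms by simp
  also have "H #> group_comm G x y = group_comm (G Mod H) (H #> x) (H #> y)"
    using assms by (simp del: mult_FactGroup)
  also have "\<dots> = \<one>\<^bsub>G Mod H\<^esub> \<longleftrightarrow> (H #> x) \<otimes>\<^bsub>G Mod H\<^esub> (H #> y) = (H #> y) \<otimes>\<^bsub>G Mod H\<^esub> (H #> x)"
    using assms by (intro q.H.comm_eq_one_iff) auto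
  finally show ?thesis .
qed

text \<open>Followed by \<open>comm_mem\<close>, this passes from commutators of generators to all
  commutators: the quotient is generated by commuting elements.\<close>

lemma comm_group_Mod_generate:
  assumes S: "S \<subseteq> carrier G" "generate G S = carrier G"
    and c: "\<And>x y. x \<in> S \<Longrightarrow> y \<in> S \<Longrightarrow> group_comm G x y \<in> H"
  shows "comm_group (G Mod H)"
proof (rule group.comm_group_generate[OF factorgroup_is_group _ Mod_generate[OF S]])
  interpret q: group_hom G "G Mod H" "(#>) H" by (rule group_hom_Mod)
  show "(\<lambda>x. H #> x) ` S \<subseteq> carrier (G Mod H)" using S by auto
  fix x y assume "x \<in> (\<lambda>x. H #> x) ` S" "y \<in> (\<lambda>x. H #> x) ` S"
  then obtain u v where "u \<in> S" "x = H #> u" "v \<in> S" "y = H #> v" by blast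
  then show "x \<otimes>\<^bsub>G Mod H\<^esub> y = y \<otimes>\<^bsub>G Mod H\<^esub> x"
    using c[of u v] comm_mem_iff[of u v] S by (simp del: mult_FactGroup add: subset_iff)
qed

lemma comm_mem:
  assumes "comm_group (G Mod H)" "x \<in> carrier G" "y \<in> carrier G"
  shows "group_comm G x y \<in> H"
proof -
  interpret q: group_hom G "G Mod H" "(#>) H" by (rule group_hom_Mod)
  show ?thesis
    unfolding comm_mem_iff[OF assms(2,3)]
    by (rule comm_groupE(4)[OF assms(1) q.hom_closed q.hom_closed]) (use assms in auto)
qed

end

lemma (in group) central_normal:
  assumes "subgroup C G" "C \<subseteq> group_centre G"
  shows "C \<lhd> G"
proof (rule normal_invI[OF assms(1)])
  fix x h assume x: "x \<in> carrier G" and h: "h \<in> C"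
  then have hc: "h \<in> carrier G" "h \<otimes> x = x \<otimes> h" using assms(2) by (auto simp: group_centre_def)
  then have "x \<otimes> h \<otimes> inv x = h" using x by (simp flip: hc(2)) (simp add: m_assoc)
  then show "x \<otimes> h \<otimes> inv x \<in> C" using h by simp
qed

section \<open>Exponent sums and words in abelian groups\<close>

primrec exponent_sum :: "'x \<Rightarrow> 'x word \<Rightarrow> int" where
  "exponent_sum x [] = 0"
| "exponent_sum x (l # w) =
     (if fst l = x then (if snd l then 1 else - 1) else 0) + exponent_sum x w"

lemma (in comm_group) word_eval_finprod:
  assumes X: "finite X" and \<gamma>: "\<And>x. \<gamma> x \<in> carrier G" and w: "w \<in> lists (X \<times> UNIV)"
  shows "word_eval G \<gamma> w = finprod G (\<lambda>x. \<gamma> x [^] exponent_sum x w) X"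
  using w
proof (induction w rule: lists.induct)
  case Nil
  show ?case by (simp add: finprod_one_eqI)
next
  case (Cons l w)
  obtain y b where l: "l = (y, b)" by (cases l)
  define e :: int where "e = (if b then 1 else - 1)"
  have y: "y \<in> X" using Cons l by auto
  \<comment> \<open>The first letter is written as a product over \<open>X\<close> whose factors are
    trivial except at its own generator \<open>y\<close>.\<close>
  have "finprod G (\<lambda>x. \<gamma> x [^] exponent_sum x (l # w)) X =
      finprod G (\<lambda>x. (if y = x then \<gamma> x [^] e else \<one>) \<otimes> \<gamma> x [^] exponent_sum x w) X"
    using \<gamma> by (intro finprod_cong) (auto simp: l e_def simp_implies_def int_pow_mult)
  also have "\<dots> = finprod G (\<lambda>x. if y = x then \<gamma> x [^] e else \<one>) X \<otimes>
      finprod G (\<lambda>x. \<gamma> x [^] exponent_sum x w) X"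
    using \<gamma> by (intro finprod_multf) auto
  also have "finprod G (\<lambda>x. if y = x then \<gamma> x [^] e else \<one>) X = \<gamma> y [^] e"
    using \<gamma> X y by (intro finprod_singleton) auto
  also have "\<gamma> y [^] e = (if b then \<gamma> y else inv \<gamma> y)"
    using \<gamma> by (simp add: e_def int_pow_neg)
  finally show ?case using Cons.IH by (simp add: l)
qed

lemma (in comm_group) word_eval_eq_one:
  assumes "finite X" "\<And>x. \<gamma> x \<in> carrier G" "w \<in> lists (X \<times> UNIV)"
    "\<And>x. x \<in> X \<Longrightarrow> \<gamma> x = \<one> \<or> exponent_sum x w = 0"
  shows "word_eval G \<gamma> w = \<one>"
  unfolding word_eval_finprod[OF assms(1,2,3)]
proof (rule finprod_one_eqI)
  show "\<gamma> x [^] exponent_sum x w = \<one>" if "x \<in> X" for x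
    using assms(4)[OF that] by (auto simp: int_pow_one)
qed

lemma finite_mixed_gens [simp]: "finite (mixed_gens k n g)"
  by (simp add: mixed_gens_def)

section \<open>The central subgroup generated by \<open>s\<close>, \<open>t\<close> and
  \<open>z\<close>\<close>

context mixed_quotient_const
begin

abbreviation "C \<equiv> generate K {s, t, z}"

lemma centre: "s \<in> group_centre K" "t \<in> group_centre K" "z \<in> group_centre K"
proof -
  have S: "\<kappa> ` mixed_gens k n g \<subseteq> carrier K" by auto
  have zz: "1 \<in> {1..n}" using n3 by simp
  have "s \<otimes> \<kappa> x = \<kappa> x \<otimes> s \<and> t \<otimes> \<kappa> x = \<kappa> x \<otimes> t \<and> z \<otimes> \<kappa> x = \<kappa> x \<otimes> z"
    if "x \<in> mixed_gens k n g" for x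
  proof (cases x)
    case (Sig i)
    then have "\<kappa> x = s" using that Sig_eq[of i] by (auto simp: mixed_gens_def)
    then show ?thesis using SigT_Sig Sig_Zet[OF zz] by simp
  next
    case (SigT i)
    then have "\<kappa> x = t" using that SigT_eq[of i] by (auto simp: mixed_gens_def)
    then show ?thesis using SigT_Sig SigT_Zet by simp
  next
    case (Zet i)
    then have "\<kappa> x = z" using that Zet_eq[of i] by (auto simp: mixed_gens_def)
    then show ?thesis using SigT_Zet Sig_Zet[OF zz] by simp
  next
    case (GenA i)
    then have "i \<in> {1..g}" using that by (auto simp: mixed_gens_def)
    then show ?thesis using GenA Sig_GenA SigT_GenA Zet_GenA by simp
  next
    case (GenB i)
    then have "i \<in> {1..g}" using that by (auto simp: mixed_gens_def)
    then show ?thesis using GenB Sig_GenB SigT_GenB Zet_GenB by simp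
  next
    case (GenAT i)
    then have "i \<in> {1..g}" using that by (auto simp: mixed_gens_def)
    then show ?thesis using GenAT Sig_GenAT SigT_GenAT Zet_GenAT by simp
  next
    case (GenBT i)
    then have "i \<in> {1..g}" using that by (auto simp: mixed_gens_def)
    then show ?thesis using GenBT Sig_GenBT SigT_GenBT Zet_GenBT by simp
  qed
  then show "s \<in> group_centre K" "t \<in> group_centre K" "z \<in> group_centre K"
    by (auto intro!: centre_generateI[OF S gen])
qed

lemma C_subset_centre: "C \<subseteq> group_centre K"
  using centre by (intro generate_subgroup_incl centre_subgroup) auto

lemma C_normal: "C \<lhd> K"
  by (intro central_normal C_subset_centre generate_is_subgroup) auto

lemma mixed_gens_cases:
  assumes "x \<in> mixed_gens k n g"
  shows "\<kappa> x \<in> {s, t, z} \<or> (\<exists>i\<in>{1..g}. x \<in> {GenA i, GenB i, GenAT i, GenBT i})"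
proof (cases x)
  case (Sig i)
  then show ?thesis using assms Sig_eq[of i] by (auto simp: mixed_gens_def)
next
  case (SigT i)
  then show ?thesis using assms SigT_eq[of i] by (auto simp: mixed_gens_def)
next
  case (Zet i)
  then show ?thesis using assms Zet_eq[of i] by (auto simp: mixed_gens_def)
qed (use assms in \<open>auto simp: mixed_gens_def\<close>)

text \<open>Collects the commutators computed above. Since the commutator of \<open>y\<close> and
  \<open>x\<close> is inverse to that of \<open>x\<close> and \<open>y\<close>, one order of each
  pair suffices.\<close>

lemma comm_gens_C:
  assumes "x \<in> mixed_gens k n g" "y \<in> mixed_gens k n g"
  shows "group_comm K (\<kappa> x) (\<kappa> y) \<in> C"
proof -
  define P where "P x y \<longleftrightarrow> group_comm K (\<kappa> x) (\<kappa> y) \<in> C" for x y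
  have C: "s \<in> C" "t \<in> C" "z \<in> C" "inv z \<in> C" "s \<otimes> s \<in> C" "t \<otimes> t \<in> C" "\<one> \<in> C"
    by (auto intro: generate.intros)
  have sym: "P x y" if "P y x" for x y
    using generate_m_inv_closed[of "{s, t, z}", OF _ that[unfolded P_def]]
    by (simp add: P_def inv_group_comm)
  have eq: "P x y" if "c \<in> C" "\<kappa> x \<otimes> \<kappa> y = c \<otimes> (\<kappa> y \<otimes> \<kappa> x)" for c x y
  proof -
    have "c \<in> carrier K" using that(1) by (rule generate_in_carrier[rotated]) auto
    then have "group_comm K (\<kappa> x) (\<kappa> y) = c"
      using comm_commute[of "\<kappa> x" "\<kappa> y"] that(2) by simp
    then show ?thesis using that(1) by (simp add: P_def)
  qed
  have comm: "P x y" if "\<kappa> x \<otimes> \<kappa> y = \<kappa> y \<otimes> \<kappa> x" for x y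
    using eq[OF C(7)] that by simp
  have central: "P x y" if "\<kappa> x \<in> {s, t, z}" for x y
    using that centre by (intro comm) (auto simp: group_centre_def)
  consider "\<kappa> x \<in> {s, t, z}" | "\<kappa> y \<in> {s, t, z}"
    | i j where "i \<in> {1..g}" "j \<in> {1..g}" "x \<in> {GenA i, GenB i, GenAT i, GenBT i}"
        "y \<in> {GenA j, GenB j, GenAT j, GenBT j}"
    using assms[THEN mixed_gens_cases] by meson
  then have "P x y"
  proof cases
    case 1
    then show "P x y" by (rule central)
  next
    case 2
    then show "P x y" by (intro sym[OF central])
  next
    case ij: (3 i j)
    have lt: "P x y"
      if "i \<in> {1..g}" "j \<in> {1..g}" "i < j" and x: "x \<in> {GenA i, GenB i, GenAT i, GenBT i}"
        and y: "y \<in> {GenA j, GenB j, GenAT j, GenBT j}" for i j x y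
    proof -
      have m: "P d c" "P c d" if "c \<in> {GenAT i, GenBT i}" "d \<in> {GenA j, GenB j}" "i \<in> {1..g}"
          "j \<in> {1..g}" "i \<noteq> j" for c d i j
        using mixed_handles_commute[OF that(3,4,5,1,2)] by (auto intro: comm)
      have "x \<in> {GenA i, GenB i} \<or> x \<in> {GenAT i, GenBT i}"
        "y \<in> {GenA j, GenB j} \<or> y \<in> {GenAT j, GenBT j}" using x y by auto
      then consider "x \<in> {GenA i, GenB i}" "y \<in> {GenA j, GenB j}"
        | "x \<in> {GenAT i, GenBT i}" "y \<in> {GenAT j, GenBT j}"
        | "x \<in> {GenAT i, GenBT i}" "y \<in> {GenA j, GenB j}"
        | "x \<in> {GenA i, GenB i}" "y \<in> {GenAT j, GenBT j}" by argo
      then show ?thesis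
      proof cases
        case 1
        then show ?thesis by (rule comm[OF handles_commute(1)[OF that(1,2,3)]])
      next
        case 2
        then show ?thesis by (rule comm[OF handles_commute(2)[OF that(1,2,3)]])
      next
        case 3
        then show ?thesis using that(1-3) by (intro m(2)[of x i y j]) auto
      next
        case 4
        then show ?thesis using that(1-3) by (intro m(1)[of y j x i]) auto
      qed
    qed
    have same: "P x y" if "i \<in> {1..g}" "x \<in> {GenA i, GenB i, GenAT i, GenBT i}"
        "y \<in> {GenA i, GenB i, GenAT i, GenBT i}" for i x y
    proof -
      have "P x x" for x by (rule comm) simp
      moreover have "P (GenA i) (GenB i)" "P (GenAT i) (GenBT i)"
        using handle_comm[OF that(1)] C by (auto intro: eq)
      moreover have "P (GenAT i) (GenA i)" "P (GenBT i) (GenB i)"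
        using same_handle_commute[OF that(1)] by (auto intro: comm)
      moreover have "P (GenAT i) (GenB i)" "P (GenBT i) (GenA i)"
        using mixed_handle_comm[OF that(1)] C by (auto intro: eq)
      ultimately show ?thesis using that(2,3) sym by auto
    qed
    consider "i < j" | "i = j" | "j < i" by linarith
    then show "P x y"
    proof cases
      case 1
      then show ?thesis by (intro lt[OF ij(1,2) _ ij(3,4)])
    next
      case 2
      with ij show ?thesis by (intro same[of i]) auto
    next
      case 3
      show ?thesis
        by (rule sym, rule lt[OF ij(2,1) 3 ij(4,3)])
    qed
  qed
  then show ?thesis by (simp add: P_def)
qed

lemma comm_group_Mod_C: "comm_group (K Mod C)"
proof (rule normal.comm_group_Mod_generate[OF C_normal _ gen])
  show "\<kappa> ` mixed_gens k n g \<subseteq> carrier K" by auto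
  show "group_comm K x y \<in> C" if "x \<in> \<kappa> ` mixed_gens k n g" "y \<in> \<kappa> ` mixed_gens k n g" for x y
    using that comm_gens_C by blast
qed

lemma comm_C: "x \<in> carrier K \<Longrightarrow> y \<in> carrier K \<Longrightarrow> group_comm K x y \<in> C"
  by (rule normal.comm_mem[OF C_normal comm_group_Mod_C])

text \<open>All commutators lie in \<open>C\<close>, which is central. This is the reason why
  condition (c) implies condition (a).\<close>

lemma class_two: "class_two K"
  unfolding class_two_def using comm_C C_subset_centre by blast

text \<open>Modulo \<open>C\<close> the group is abelian and all generators other than the handle
  generators die, so only the handle exponents of a word matter there.\<close>

lemma word_eval_mem_C:
  assumes w: "w \<in> lists (mixed_gens k n g \<times> UNIV)"
    and e: "\<And>x i. i \<in> {1..g} \<Longrightarrow> x \<in> {GenA i, GenB i, GenAT i, GenBT i} \<Longrightarrow> exponent_sum x w = 0"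
  shows "word_eval K \<kappa> w \<in> C"
proof -
  interpret q: normal C K by (rule C_normal)
  interpret A: comm_group "K Mod C" by (rule comm_group_Mod_C)
  interpret h: group_hom K "K Mod C" "(#>) C" by (rule q.group_hom_Mod)
  have \<kappa>: "\<kappa> ` mixed_gens k n g \<subseteq> carrier K" by auto
  have "C #> word_eval K \<kappa> w = word_eval (K Mod C) ((#>) C \<circ> \<kappa>) w"
    by (rule h.hom_word_eval[OF \<kappa> w])
  also have "\<dots> = \<one>\<^bsub>K Mod C\<^esub>"
  proof (rule A.word_eval_eq_one[OF finite_mixed_gens _ w])
    show "((#>) C \<circ> \<kappa>) x \<in> carrier (K Mod C)" for x
      using h.hom_closed[of "\<kappa> x"] by simp
    fix x assume x: "x \<in> mixed_gens k n g"
    then have "\<kappa> x \<in> {s, t, z} \<or> exponent_sum x w = 0"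
      using mixed_gens_cases[OF x] e by blast
    moreover have "\<kappa> x \<in> C" if "\<kappa> x \<in> {s, t, z}" using that by (rule generate.incl)
    ultimately show "((#>) C \<circ> \<kappa>) x = \<one>\<^bsub>K Mod C\<^esub> \<or> exponent_sum x w = 0"
      using q.rcos_eq_one_iff[of "\<kappa> x"] by auto
  qed
  finally show ?thesis using q.rcos_eq_one_iff word_eval_closed[OF \<kappa> w] by simp
qed

end


section \<open>A model of the quotient by the third term of the lower central series\<close>

locale biadditive =
  fixes \<beta> :: "'f::ab_group_add \<Rightarrow> 'f \<Rightarrow> 'c::ab_group_add"
  assumes add_left: "\<beta> (x + y) w = \<beta> x w + \<beta> y w"
    and add_right: "\<beta> w (x + y) = \<beta> w x + \<beta> w y"
begin

lemma zero_left [simp]: "\<beta> 0 w = 0"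
  using add_left[of 0 0 w] by simp

lemma zero_right [simp]: "\<beta> w 0 = 0"
  using add_right[of w 0 0] by simp

lemma minus_left: "\<beta> (- x) w = - \<beta> x w"
  using add_left[of "- x" x w] by (simp add: eq_neg_iff_add_eq_0)

lemma minus_right: "\<beta> w (- x) = - \<beta> w x"
  using add_right[of w "- x" x] by (simp add: eq_neg_iff_add_eq_0)

lemma diff_left: "\<beta> (x - y) w = \<beta> x w - \<beta> y w"
  using add_left[of "x - y" y w] by simp

lemma diff_right: "\<beta> w (x - y) = \<beta> w x - \<beta> w y"
  using add_right[of w "x - y" y] by simp

lemmas biadditive_simps = add_left add_right minus_left minus_right diff_left diff_right

text \<open>The central extension of \<open>'f\<close> by \<open>'c\<close> with cocycle
  \<open>\<beta>\<close>, as for a Heisenberg group: the commutator of \<open>(c, v)\<close> and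
  \<open>(d, w)\<close> is \<open>(\<beta> v w - \<beta> w v, 0)\<close>.\<close>

definition extension :: "('c \<times> 'f) monoid" where
  "extension = \<lparr>carrier = UNIV,
     mult = (\<lambda>p q. (fst p + fst q + \<beta> (snd p) (snd q), snd p + snd q)), one = (0, 0)\<rparr>"

lemma extension_simps [simp]:
  "carrier extension = UNIV"
  "p \<otimes>\<^bsub>extension\<^esub> q = (fst p + fst q + \<beta> (snd p) (snd q), snd p + snd q)"
  "\<one>\<^bsub>extension\<^esub> = (0, 0)"
  by (simp_all add: extension_def)

lemma group_extension: "group extension"
proof (rule groupI)
  fix p :: "'c \<times> 'f"
  show "\<exists>q\<in>carrier extension. q \<otimes>\<^bsub>extension\<^esub> p = \<one>\<^bsub>extension\<^esub>"
    by (intro bexI[of _ "(- fst p + \<beta> (snd p) (snd p), - snd p)"]) (simp_all add: minus_left)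
qed (simp_all add: add_left add_right algebra_simps)

lemma inv_extension [simp]:
  "inv\<^bsub>extension\<^esub> p = (- fst p + \<beta> (snd p) (snd p), - snd p)"
  using group.inv_equality[OF group_extension, of "(- fst p + \<beta> (snd p) (snd p), - snd p)" p]
  by (simp add: minus_left)

lemma class_two_extension: "class_two extension"
  by (simp add: class_two_def group_centre_def algebra_simps)

end

definition unit_vec :: "'x \<Rightarrow> 'x \<Rightarrow> int" where
  "unit_vec x y = (if y = x then 1 else 0)"

text \<open>The components are the exponents of \<open>\<sigma>\<close>, of its tilde version and of
  \<open>\<zeta>\<close>. The form is one-sided rather than alternating: an alternating form would
  double in commutators and could not produce the exponent 1 of \<open>\<zeta>\<close> over the
  integers.\<close>

definition handle_form ::
    "nat \<Rightarrow> (mixed_gen \<Rightarrow> int) \<Rightarrow> (mixed_gen \<Rightarrow> int) \<Rightarrow> int \<times> int \<times> int" where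
  "handle_form g f h =
     (\<Sum>i=1..g. 2 * f (GenA i) * h (GenB i), \<Sum>i=1..g. 2 * f (GenAT i) * h (GenBT i),
      \<Sum>i=1..g. f (GenAT i) * h (GenB i) + f (GenA i) * h (GenBT i))"

interpretation handle_form: biadditive "handle_form g" for g
  by unfold_locales (simp_all add: handle_form_def sum.distrib algebra_simps)

text \<open>A table that lets relators be evaluated by rewriting; the range test reflects that the
  sums in \<open>handle_form\<close> run over \<open>1..g\<close> only.\<close>

fun handle_pairing :: "nat \<Rightarrow> mixed_gen \<Rightarrow> mixed_gen \<Rightarrow> int \<times> int \<times> int" where
  "handle_pairing g (GenA i) (GenB j) = (if i = j \<and> i \<in> {1..g} then (2, 0, 0) else 0)"
| "handle_pairing g (GenAT i) (GenBT j) = (if i = j \<and> i \<in> {1..g} then (0, 2, 0) else 0)"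
| "handle_pairing g (GenAT i) (GenB j) = (if i = j \<and> i \<in> {1..g} then (0, 0, 1) else 0)"
| "handle_pairing g (GenA i) (GenBT j) = (if i = j \<and> i \<in> {1..g} then (0, 0, 1) else 0)"
| "handle_pairing g _ _ = 0"

lemma sum_delta_mult:
  assumes "finite A"
  shows "(\<Sum>l\<in>A. (if l = i then a else 0) * (if l = j then b else 0 :: int)) =
    (if i = j \<and> i \<in> A then a * b else 0)"
proof -
  have "(\<Sum>l\<in>A. (if l = i then a else 0) * (if l = j then b else 0)) =
      (\<Sum>l\<in>A. if l = i then (if i = j then a * b else 0) else 0)"
    by (intro sum.cong) auto
  then show ?thesis using assms by (simp add: sum.delta)
qed

lemma handle_form_unit_vec [simp]:
  "handle_form g (unit_vec x) (unit_vec y) = handle_pairing g x y"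
proof -
  have *: "(\<Sum>l = Suc 0..g. (if l = i then a else 0) * (if l = j then b else 0 :: int)) =
    (if i = j \<and> i \<in> {1..g} then a * b else 0)" for i j a b
    using sum_delta_mult[of "{1..g}" i a j b] by simp
  have if2: "2 * (if P then 1 else 0 :: int) = (if P then 2 else 0)" for P by simp
  show ?thesis
    by (cases x; cases y)
      (auto simp: handle_form_def unit_vec_def zero_prod_def if2 *)
qed

text \<open>The index of a braid or \<open>Zet\<close> letter is dropped because such letters of one
  kind coincide in every quotient of class two.\<close>

fun model_gen :: "mixed_gen \<Rightarrow> (int \<times> int \<times> int) \<times> (mixed_gen \<Rightarrow> int)" where
  "model_gen (Sig i) = ((1, 0, 0), 0)"
| "model_gen (SigT i) = ((0, 1, 0), 0)"
| "model_gen (Zet i) = ((0, 0, 1), 0)"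
| "model_gen x = (0, unit_vec x)"

abbreviation model :: "nat \<Rightarrow> ((int \<times> int \<times> int) \<times> (mixed_gen \<Rightarrow> int)) monoid" where
  "model g \<equiv> handle_form.extension g"

text \<open>Each relation becomes an identity between integer vectors. The factor 2 in
  \<open>handle_form\<close> comes from the relation between \<open>a_i\<close>,
  \<open>\<sigma>_1\<close> and \<open>b_i\<close>, where \<open>\<sigma>_1\<close> occurs once on
  the left and three times on the right.\<close>

lemma model_rel:
  assumes "mixed_rel k n g u v"
  shows "word_eval (model g) model_gen u = word_eval (model g) model_gen v"
proof -
  have surface:
    "word_eval (model g) model_gen u = word_eval (model g) model_gen v"
    if "surface_rel m g (\<lambda>i. letter (Sig i)) (\<lambda>i. letter (GenA i)) (\<lambda>i. letter (GenB i)) u v \<or>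
      surface_rel m g (\<lambda>i. letter (SigT i)) (\<lambda>i. letter (GenAT i)) (\<lambda>i. letter (GenBT i)) u v"
    for m u v
    using that
    by (auto elim!: surface_rel.cases
        simp: handle_form.biadditive_simps zero_prod_def algebra_simps)
  show ?thesis
    using assms
  proof cases
    case 1
    then show ?thesis using surface by blast
  next
    case 6
    then show ?thesis using surface by blast
  qed (auto simp: word_conj_def word_comm_def handle_form.biadditive_simps zero_prod_def algebra_simps)
qed

text \<open>\<open>has_presentation\<close> compares only words over the generators; with this lemma
  a relation becomes an equation in the presented group.\<close>

lemma mixed_rel_in_lists:
  assumes "mixed_rel k n g u v"
  shows "u \<in> lists (mixed_gens k n g \<times> UNIV)" "v \<in> lists (mixed_gens k n g \<times> UNIV)"
proof -
  have surface:
    "u \<in> lists (mixed_gens k n g \<times> UNIV) \<and> v \<in> lists (mixed_gens k n g \<times> UNIV)"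
    if "surface_rel k g (\<lambda>i. letter (Sig i)) (\<lambda>i. letter (GenA i)) (\<lambda>i. letter (GenB i)) u v \<or>
      surface_rel n g (\<lambda>i. letter (SigT i)) (\<lambda>i. letter (GenAT i)) (\<lambda>i. letter (GenBT i)) u v"
    for u v
    using that by (auto elim!: surface_rel.cases simp: mixed_gens_def)
  have "u \<in> lists (mixed_gens k n g \<times> UNIV) \<and> v \<in> lists (mixed_gens k n g \<times> UNIV)"
    using assms
  proof cases
    case 1
    then show ?thesis using surface by blast
  next
    case 6
    then show ?thesis using surface by blast
  qed (auto simp: word_conj_def word_comm_def mixed_gens_def)
  then show "u \<in> lists (mixed_gens k n g \<times> UNIV)" "v \<in> lists (mixed_gens k n g \<times> UNIV)"
    by auto
qed


section \<open>Lower central series, homomorphisms and quotients\<close>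

lemma group_centreD:
  "z \<in> group_centre G \<Longrightarrow> x \<in> carrier G \<Longrightarrow> z \<otimes>\<^bsub>G\<^esub> x = x \<otimes>\<^bsub>G\<^esub> z"
  unfolding group_centre_def by blast

lemma (in group_hom) lower_central_2_trivial:
  assumes c: "\<And>x y. x \<in> carrier G \<Longrightarrow> y \<in> carrier G \<Longrightarrow> h x \<otimes>\<^bsub>H\<^esub> h y = h y \<otimes>\<^bsub>H\<^esub> h x"
    and y: "y \<in> lower_central G 2"
  shows "h y = \<one>\<^bsub>H\<^esub>"
proof -
  have "h (group_comm G x y) = \<one>\<^bsub>H\<^esub>" if "x \<in> carrier G" "y \<in> carrier G" for x y
    using H.comm_eq_one_iff[of "h x" "h y"] c that by simp
  then have "lower_central G 2 \<subseteq> kernel G H h"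
    unfolding lower_central_2
    by (intro G.generate_subgroup_incl subgroup_kernel) (auto simp: kernel_def)
  then show ?thesis using y by (auto simp: kernel_def)
qed

text \<open>The elements that \<open>h\<close> sends into the centre form a subgroup containing all
  commutators, hence the second term. Commutators with elements of the second term therefore go to
  the identity, and they generate the third term.\<close>

lemma (in group_hom) lower_central_3_trivial:
  assumes c: "class_two H" and y: "y \<in> lower_central G 3"
  shows "h y = \<one>\<^bsub>H\<^esub>"
proof -
  interpret L: normal "lower_central G 2" G by (rule G.lower_central_normal)
  interpret Z: subgroup "group_centre H" H by (rule H.centre_subgroup)
  have sub: "subgroup {x \<in> carrier G. h x \<in> group_centre H} G"
  proof (rule G.subgroupI)
    show "inv a \<in> {x \<in> carrier G. h x \<in> group_centre H}"
      if "a \<in> {x \<in> carrier G. h x \<in> group_centre H}" for a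
      using that Z.m_inv_closed by auto
  qed (use Z.one_closed Z.m_closed in auto)
  have "h (group_comm G x y) \<in> group_centre H" if "x \<in> carrier G" "y \<in> carrier G" for x y
    using c that by (simp add: class_two_def)
  then have "lower_central G 2 \<subseteq> {x \<in> carrier G. h x \<in> group_centre H}"
    unfolding lower_central_2
    by (intro G.generate_subgroup_incl sub) auto
  then have L2: "h y \<in> group_centre H" if "y \<in> lower_central G 2" for y using that by auto
  have "h (group_comm G x y) = \<one>\<^bsub>H\<^esub>" if "x \<in> carrier G" "y \<in> lower_central G 2" for x y
  proof -
    have y: "y \<in> carrier G" using that L.subset by blast
    then have "h x \<otimes>\<^bsub>H\<^esub> h y = h y \<otimes>\<^bsub>H\<^esub> h x"
      using group_centreD[OF L2[OF that(2)], of "h x"] that(1) by simp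
    then show ?thesis using H.comm_eq_one_iff[of "h x" "h y"] y that(1) by simp
  qed
  then have *: "(\<Union>x\<in>carrier G. \<Union>y\<in>lower_central G 2. {group_comm G x y}) \<subseteq> kernel G H h"
    using L.mem_carrier by (auto simp: kernel_def)
  then have "lower_central G 3 \<subseteq> kernel G H h"
    unfolding lower_central_3 by (rule G.generate_subgroup_incl[OF _ subgroup_kernel])
  then show ?thesis using y by (auto simp: kernel_def)
qed

context group
begin

lemma comm_group_Mod_lower_central_2: "comm_group (G Mod lower_central G 2)"
proof (rule normal.comm_group_Mod_generate[OF lower_central_normal(1), of "carrier G"])
  show "generate G (carrier G) = carrier G"
    using generate_incl[of "carrier G"] generate.incl[of _ "carrier G" G] by auto
  show "group_comm G x y \<in> lower_central G 2" if "x \<in> carrier G" "y \<in> carrier G" for x y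
    unfolding lower_central_2 using that by (intro generate.incl) auto
qed simp

text \<open>A commutator \<open>c\<close> lies in the second term, so its commutator with any
  \<open>u\<close> lies in the third; hence the class of \<open>c\<close> is central.\<close>

lemma class_two_Mod_lower_central_3: "class_two (G Mod lower_central G 3)"
proof -
  interpret L2: normal "lower_central G 2" G by (rule lower_central_normal)
  interpret L: normal "lower_central G 3" G by (rule lower_central_normal)
  interpret q: group_hom G "G Mod lower_central G 3" "(#>) (lower_central G 3)" by (rule L.group_hom_Mod)
  let ?q = "\<lambda>x. lower_central G 3 #> x"
  have "group_comm (G Mod lower_central G 3) (?q x) (?q y) \<in> group_centre (G Mod lower_central G 3)"
    if xy: "x \<in> carrier G" "y \<in> carrier G" for x y
  proof -
    define c where "c = group_comm G x y"
    have c: "c \<in> lower_central G 2" "c \<in> carrier G"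
      unfolding c_def lower_central_2 using xy by (auto intro!: generate.incl)
    have "group_comm G u c \<in> lower_central G 3" if "u \<in> carrier G" for u
      unfolding lower_central_3 using that c by (intro generate.incl) auto
    then have "?q u \<otimes>\<^bsub>G Mod lower_central G 3\<^esub> ?q c = ?q c \<otimes>\<^bsub>G Mod lower_central G 3\<^esub> ?q u"
      if "u \<in> carrier G" for u
      using L.comm_mem_iff[OF that c(2)] that by blast
    moreover have "?q c = group_comm (G Mod lower_central G 3) (?q x) (?q y)"
      unfolding c_def using xy by (simp del: mult_FactGroup)
    ultimately show ?thesis
      using q.hom_closed[OF c(2)] unfolding group_centre_def
      by (simp add: carrier_FactGroup del: mult_FactGroup)
  qed
  then show ?thesis
    unfolding class_two_def by (simp add: carrier_FactGroup del: mult_FactGroup)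
qed

lemma factors_through_Mod_iff:
  assumes N: "N \<lhd> G" and H: "group H" and f: "f \<in> hom G H"
  shows "factors_through G (G Mod N) H f (\<lambda>x. N #> x) \<longleftrightarrow> (\<forall>x\<in>N. f x = \<one>\<^bsub>H\<^esub>)"
proof
  interpret N: normal N G by (rule N)
  interpret q: group_hom G "G Mod N" "(#>) N" by (rule N.group_hom_Mod)
  assume "factors_through G (G Mod N) H f (\<lambda>x. N #> x)"
  then obtain h where h: "h \<in> hom (G Mod N) H" "\<And>x. x \<in> carrier G \<Longrightarrow> f x = h (N #> x)"
    by (auto simp: factors_through_def)
  show "\<forall>x\<in>N. f x = \<one>\<^bsub>H\<^esub>"
  proof
    fix x assume x: "x \<in> N"
    then have x': "x \<in> carrier G" using N.subset by auto
    then have "f x = h (\<one>\<^bsub>G Mod N\<^esub>)" using h(2) N.rcos_eq_one_iff[OF x'] x by simp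
    also have "\<dots> = \<one>\<^bsub>H\<^esub>" using hom_one[OF h(1) _ H] q.H.is_group by blast
    finally show "f x = \<one>\<^bsub>H\<^esub>" .
  qed
next
  interpret N: normal N G by (rule N)
  interpret f: group_hom G H f using H f by (simp add: group_hom_def group_hom_axioms_def is_group)
  assume N1: "\<forall>x\<in>N. f x = \<one>\<^bsub>H\<^esub>"
  obtain h where "h \<in> hom (G Mod N) H" "\<And>x. x \<in> carrier G \<Longrightarrow> h (N #> x) = f x"
  proof (rule FactGroup_universal[OF f N])
    fix x y assume xy: "x \<in> carrier G" "y \<in> carrier G" "N #> x = N #> y"
    then have "x \<otimes> inv y \<in> N"
      using N.rcos_module[OF is_group xy(2,1)] rcos_self[OF xy(1) N.subgroup_axioms] by simp
    then have "f x \<otimes>\<^bsub>H\<^esub> inv\<^bsub>H\<^esub> f y = \<one>\<^bsub>H\<^esub>" using N1 xy by force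
    then show "f x = f y" using xy by (simp add: f.H.inv_solve_right')
  qed blast
  then show "factors_through G (G Mod N) H f (\<lambda>x. N #> x)"
    unfolding factors_through_def by (intro bexI[of _ h]) auto
qed

end

text \<open>Applied with \<open>M\<close> a term of the lower central series or the kernel of a
  homomorphism.\<close>

lemma mixed_quotient_Mod:
  assumes P: "has_presentation G \<gamma> (mixed_gens k n g) (mixed_rel k n g)"
    and \<gamma>: "\<And>x. \<gamma> x \<in> carrier G" and M: "M \<lhd> G" and kn: "3 \<le> k" "3 \<le> n"
  shows "mixed_quotient (G Mod M) (\<lambda>x. M #>\<^bsub>G\<^esub> \<gamma> x) k n g"
proof -
  interpret M: normal M G by (rule M)
  interpret q: group_hom G "G Mod M" "(#>\<^bsub>G\<^esub>) M" by (rule M.group_hom_Mod)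
  have \<gamma>': "\<gamma> ` mixed_gens k n g \<subseteq> carrier G" using \<gamma> by auto
  have gen: "generate G (\<gamma> ` mixed_gens k n g) = carrier G"
    using P by (simp add: has_presentation_def)
  show ?thesis
  proof unfold_locales
    show "M #>\<^bsub>G\<^esub> \<gamma> x \<in> carrier (G Mod M)" for x using \<gamma> by (rule q.hom_closed)
    show "generate (G Mod M) ((\<lambda>x. M #>\<^bsub>G\<^esub> \<gamma> x) ` mixed_gens k n g) = carrier (G Mod M)"
      using M.Mod_generate[OF \<gamma>' gen] by (simp add: image_image)
    fix u v assume uv: "mixed_rel k n g u v"
    note l = mixed_rel_in_lists[OF uv]
    have "word_eval G \<gamma> u = word_eval G \<gamma> v"
      using P l word_eq.relation[of "mixed_rel k n g" u v "mixed_gens k n g", OF uv]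
      unfolding has_presentation_def by blast
    then show "word_eval (G Mod M) (\<lambda>x. M #>\<^bsub>G\<^esub> \<gamma> x) u = word_eval (G Mod M) (\<lambda>x. M #>\<^bsub>G\<^esub> \<gamma> x) v"
      using q.hom_word_eval[OF \<gamma>' l(1)] q.hom_word_eval[OF \<gamma>' l(2)] by (simp add: comp_def)
  qed (use kn in auto)
qed

lemma (in mixed_quotient) mixed_quotient_constI:
  assumes "class_two K"
  shows "mixed_quotient_const K \<kappa> k n g"
proof unfold_locales
  show "\<kappa> (Sig i) = \<kappa> (Sig 1)" if "i \<in> {1..<k}" for i
    using braid_Sig[OF assms] by (intro eq_first[OF _ that, of "\<lambda>i. \<kappa> (Sig i)"]) auto
  show "\<kappa> (SigT i) = \<kappa> (SigT 1)" if "i \<in> {1..<n}" for i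
    using braid_SigT[OF assms] by (intro eq_first[OF _ that, of "\<lambda>i. \<kappa> (SigT i)"]) auto
qed

lemma (in comm_group) class_two_comm_group: "class_two G"
  by (simp add: class_two_def group_centre_def m_comm)

text \<open>\<open>exponent_sum\<close> counts a single letter; after merging, the sum at
  \<open>Sig 1\<close> is the total exponent of all letters \<open>Sig i\<close>, and similarly for
  the other two kinds.\<close>

definition merge_gen :: "mixed_gen \<Rightarrow> mixed_gen" where
  "merge_gen x = (case x of Sig _ \<Rightarrow> Sig 1 | SigT _ \<Rightarrow> SigT 1 | Zet _ \<Rightarrow> Zet 1 | _ \<Rightarrow> x)"

lemma word_eval_map: "word_eval G \<gamma> (map (apfst c) w) = word_eval G (\<gamma> \<circ> c) w"
  by (induction w) (auto simp: word_eval_def)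

lemma snd_word_eval_model:
  "y \<in> {GenA i, GenB i, GenAT i, GenBT i} \<Longrightarrow>
    snd (word_eval (model g) model_gen w) y = exponent_sum y w"
proof (induction w)
  case (Cons l w)
  obtain x b where l: "l = (x, b)" by (cases l)
  have "snd (model_gen x) y = (if x = y then 1 else 0)"
    using Cons.prems by (cases x) (auto simp: unit_vec_def)
  then show ?case using Cons l by auto
qed simp

text \<open>Disc letters lie in the central factor, where multiplication is plain addition, so the
  model counts total exponents.\<close>

lemma fst_word_eval_model:
  assumes "w \<in> lists (mixed_gens k n 0 \<times> UNIV)"
  shows "word_eval (model g) model_gen w =
    ((exponent_sum (Sig 1) (map (apfst merge_gen) w), exponent_sum (SigT 1) (map (apfst merge_gen) w),
      exponent_sum (Zet 1) (map (apfst merge_gen) w)), 0)"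
  using assms
proof (induction w rule: lists.induct)
  case (Cons l w)
  then show ?case by (cases l) (auto simp: mixed_gens_def merge_gen_def)
qed (simp add: zero_fun_def zero_prod_def)


section \<open>The inclusion of the braid group of the disc\<close>

text \<open>The algebra extracted from the topology: two presentations and a homomorphism matching
  the disc generators. The generator maps are total in the carriers.\<close>

locale braid_inclusion =
  fixes B :: "('b, 'x) monoid_scheme" and D :: "('d, 'y) monoid_scheme"
    and \<gamma>B :: "mixed_gen \<Rightarrow> 'b" and \<gamma>D :: "mixed_gen \<Rightarrow> 'd" and \<iota> :: "'d \<Rightarrow> 'b"
    and k n g :: nat
  assumes k3: "3 \<le> k" and n3: "3 \<le> n"
    and presentation_B: "has_presentation B \<gamma>B (mixed_gens k n g) (mixed_rel k n g)"
    and presentation_D: "has_presentation D \<gamma>D (mixed_gens k n 0) (mixed_rel k n 0)"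
    and gB [simp]: "\<gamma>B x \<in> carrier B" and gD [simp]: "\<gamma>D x \<in> carrier D"
    and \<iota>_hom: "\<iota> \<in> hom D B"
    and \<iota>_gens: "x \<in> mixed_gens k n 0 \<Longrightarrow> \<iota> (\<gamma>D x) = \<gamma>B x"
begin

abbreviation "QB \<equiv> B Mod lower_central B 3"
abbreviation "QD \<equiv> D Mod lower_central D 2"
abbreviation "\<rho> \<equiv> (#>\<^bsub>B\<^esub>) (lower_central B 3)"
abbreviation "r \<equiv> (#>\<^bsub>D\<^esub>) (lower_central D 2)"

sublocale B: group B using presentation_B by (simp add: has_presentation_def)
sublocale D: group D using presentation_D by (simp add: has_presentation_def)
sublocale \<iota>: group_hom D B \<iota> by unfold_locales (rule \<iota>_hom)
sublocale LB: normal "lower_central B 3" B by (rule B.lower_central_normal)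
sublocale LD: normal "lower_central D 2" D by (rule D.lower_central_normal)
sublocale \<rho>: group_hom B QB \<rho> by (rule LB.group_hom_Mod)
sublocale r: group_hom D QD r by (rule LD.group_hom_Mod)
sublocale QD: comm_group QD by (rule D.comm_group_Mod_lower_central_2)

lemma class_two_QB: "class_two QB"
  by (rule B.class_two_Mod_lower_central_3)

text \<open>Class two collapses the relations in \<open>QB\<close>; \<open>QD\<close>, being
  abelian, falls under the same locale with \<open>g = 0\<close>.\<close>

sublocale Q: mixed_quotient_const QB "\<lambda>x. \<rho> (\<gamma>B x)" k n g
  by (intro mixed_quotient.mixed_quotient_constI mixed_quotient_Mod presentation_B gB
      B.lower_central_normal(2) class_two_QB k3 n3)

sublocale R: mixed_quotient_const QD "\<lambda>x. r (\<gamma>D x)" k n 0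
  by (intro mixed_quotient.mixed_quotient_constI mixed_quotient_Mod presentation_D gD
      D.lower_central_normal(1) QD.class_two_comm_group k3 n3)

lemma Sig_in_gens: "Sig 1 \<in> mixed_gens k n j" "SigT 1 \<in> mixed_gens k n j" "Zet 1 \<in> mixed_gens k n j"
  using k3 n3 by (auto simp: mixed_gens_def)

lemma B_gens: "\<gamma>B ` X \<subseteq> carrier B" by auto
lemma D_gens: "\<gamma>D ` X \<subseteq> carrier D" by auto

lemma D_generated: "generate D (\<gamma>D ` mixed_gens k n 0) = carrier D"
  using presentation_D by (simp add: has_presentation_def)

lemma B_generated: "generate B (\<gamma>B ` mixed_gens k n g) = carrier B"
  using presentation_B by (simp add: has_presentation_def)

lemma image_rho_iota: "(\<lambda>x. \<rho> (\<iota> x)) ` carrier D = Q.C"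
proof -
  interpret c: group_hom D QB "\<lambda>x. \<rho> (\<iota> x)"
    using hom_compose[OF \<iota>_hom \<rho>.homh] by unfold_locales (simp add: comp_def)
  have "(\<lambda>x. \<rho> (\<iota> x)) ` \<gamma>D ` mixed_gens k n 0 = (\<lambda>x. \<rho> (\<gamma>B x)) ` mixed_gens k n 0"
    unfolding image_image by (intro image_cong) (auto simp: \<iota>_gens)
  also have "\<dots> = {\<rho> (\<gamma>B (Sig 1)), \<rho> (\<gamma>B (SigT 1)), \<rho> (\<gamma>B (Zet 1))}" (is "_ = ?C")
  proof
    have "x \<in> mixed_gens k n g" if "x \<in> mixed_gens k n 0" for x
      using that by (auto simp: mixed_gens_def)
    moreover have "x \<notin> {GenA i, GenB i, GenAT i, GenBT i}" if "x \<in> mixed_gens k n 0" for x i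
      using that by (auto simp: mixed_gens_def)
    ultimately show "(\<lambda>x. \<rho> (\<gamma>B x)) ` mixed_gens k n 0 \<subseteq> ?C"
      using Q.mixed_gens_cases by blast
  qed (use Sig_in_gens[of 0] in blast)
  finally show ?thesis
    using c.generate_img[OF D_gens, of "mixed_gens k n 0"] D_generated by simp
qed

lemma rho_iota_commute:
  assumes "x \<in> carrier D" "y \<in> carrier B"
  shows "\<rho> (\<iota> x) \<otimes>\<^bsub>QB\<^esub> \<rho> y = \<rho> y \<otimes>\<^bsub>QB\<^esub> \<rho> (\<iota> x)"
proof (rule group_centreD)
  show "\<rho> (\<iota> x) \<in> group_centre QB"
    using image_rho_iota Q.C_subset_centre assms(1) by blast
qed (use assms in auto)

text \<open>The image of \<open>\<rho> \<circ> \<iota>\<close> is central, so this map kills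
  commutators and descends to the abelianisation \<open>QD\<close>.\<close>

lemma alpha_exists:
  obtains \<alpha> where "\<alpha> \<in> hom QD QB" "\<And>x. x \<in> carrier D \<Longrightarrow> \<alpha> (r x) = \<rho> (\<iota> x)"
proof -
  interpret c: group_hom D QB "\<lambda>x. \<rho> (\<iota> x)"
    using hom_compose[OF \<iota>_hom \<rho>.homh] by unfold_locales (simp add: comp_def)
  have "\<rho> (\<iota> y) = \<one>\<^bsub>QB\<^esub>" if "y \<in> lower_central D 2" for y
    by (rule c.lower_central_2_trivial[OF rho_iota_commute that]) auto
  then have "factors_through D QD QB (\<lambda>x. \<rho> (\<iota> x)) r"
    using D.factors_through_Mod_iff[OF D.lower_central_normal(1) \<rho>.H.is_group c.homh] by blast
  then show thesis using that unfolding factors_through_def by metis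
qed

text \<open>The model has class two, so the homomorphism given by the presentation kills the third
  term. Invariants of elements of \<open>QB\<close> can thus be read off in the model.\<close>

lemma model_hom:
  obtains \<phi> where "\<phi> \<in> hom B (model g)" "\<And>x. x \<in> mixed_gens k n g \<Longrightarrow> \<phi> (\<gamma>B x) = model_gen x"
    "\<And>y. y \<in> lower_central B 3 \<Longrightarrow> \<phi> y = \<one>\<^bsub>model g\<^esub>"
proof -
  obtain \<phi> where \<phi>: "\<phi> \<in> hom B (model g)" "\<And>x. x \<in> mixed_gens k n g \<Longrightarrow> \<phi> (\<gamma>B x) = model_gen x"
  proof (rule has_presentation_hom[OF presentation_B handle_form.group_extension,
        where \<kappa> = model_gen])
    show "model_gen x \<in> carrier (model g)" for x by simp
  qed (use model_rel in blast)+
  interpret \<phi>: group_hom B "model g" \<phi>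
    using \<phi>(1) handle_form.group_extension B.is_group
    by (simp add: group_hom_def group_hom_axioms_def)
  show thesis
    using that[OF \<phi>] \<phi>.lower_central_3_trivial[OF handle_form.class_two_extension] by blast
qed

text \<open>The model separates the powers of \<open>\<sigma>\<close>, \<open>\<sigma>~\<close> and \<open>\<zeta>\<close>.\<close>

lemma rho_iota_eq_one:
  assumes d: "d \<in> carrier D" and one: "\<rho> (\<iota> d) = \<one>\<^bsub>QB\<^esub>"
  shows "r d = \<one>\<^bsub>QD\<^esub>"
proof -
  obtain w where w: "w \<in> lists (mixed_gens k n 0 \<times> UNIV)" and dw: "d = word_eval D \<gamma>D w"
    using D.generate_word_eval[OF D_gens] d D_generated by metis
  obtain \<phi> where \<phi>: "\<phi> \<in> hom B (model g)"
      "\<And>x. x \<in> mixed_gens k n g \<Longrightarrow> \<phi> (\<gamma>B x) = model_gen x"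
      "\<And>y. y \<in> lower_central B 3 \<Longrightarrow> \<phi> y = \<one>\<^bsub>model g\<^esub>"
    by (rule model_hom) blast
  interpret \<phi>: group_hom B "model g" \<phi>
    using \<phi>(1) handle_form.group_extension B.is_group
    by (simp add: group_hom_def group_hom_axioms_def)
  have gens: "x \<in> mixed_gens k n g" if "x \<in> mixed_gens k n 0" for x
    using that by (auto simp: mixed_gens_def)
  have "\<iota> d \<in> lower_central B 3"
    using one LB.rcos_eq_one_iff[of "\<iota> d"] d by simp
  then have "\<one>\<^bsub>model g\<^esub> = \<phi> (\<iota> d)" using \<phi>(3) by simp
  also have "\<iota> d = word_eval B (\<iota> \<circ> \<gamma>D) w"
    unfolding dw by (rule \<iota>.hom_word_eval[OF D_gens w])
  also have "\<dots> = word_eval B \<gamma>B w"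
    by (rule word_eval_cong[OF w]) (simp add: \<iota>_gens)
  also have "\<phi> \<dots> = word_eval (model g) (\<phi> \<circ> \<gamma>B) w"
    by (rule \<phi>.hom_word_eval[OF B_gens w])
  also have "\<dots> = word_eval (model g) model_gen w"
    by (rule word_eval_cong[OF w]) (simp add: \<phi>(2) gens)
  \<comment> \<open>The model value of \<open>w\<close> is trivial, so the total exponents of the
    three kinds of disc letters are zero.\<close>
  finally have e: "exponent_sum x (map (apfst merge_gen) w) = 0" if "x \<in> {Sig 1, SigT 1, Zet 1}" for x
    using that unfolding fst_word_eval_model[OF w] by (auto simp: zero_prod_def)
  have "r d = word_eval QD (r \<circ> \<gamma>D) w"
    unfolding dw by (rule r.hom_word_eval[OF D_gens w])
  \<comment> \<open>Merging is harmless because letters of one kind have the same value in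
    \<open>QD\<close>.\<close>
  also have "\<dots> = word_eval QD ((r \<circ> \<gamma>D) \<circ> merge_gen) w"
  proof (rule word_eval_cong[OF w])
    fix x assume "x \<in> mixed_gens k n 0"
    then show "(r \<circ> \<gamma>D) x = ((r \<circ> \<gamma>D) \<circ> merge_gen) x"
      \<comment> \<open>The incomplete \<open>case\<close> terms extract the index of
        \<open>x\<close>; after the case split only the matching fact is relevant.\<close>
      using R.Sig_eq[of "case x of Sig i \<Rightarrow> i"] R.SigT_eq[of "case x of SigT i \<Rightarrow> i"]
        R.Zet_eq[of "case x of Zet i \<Rightarrow> i"]
      by (cases x) (auto simp: mixed_gens_def merge_gen_def)
  qed
  also have "\<dots> = word_eval QD (r \<circ> \<gamma>D) (map (apfst merge_gen) w)"
    by (simp only: word_eval_map)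
  also have "\<dots> = \<one>\<^bsub>QD\<^esub>"
  proof (rule QD.word_eval_eq_one)
    show "(r \<circ> \<gamma>D) x \<in> carrier QD" for x by simp
    show "map (apfst merge_gen) w \<in> lists ({Sig 1, SigT 1, Zet 1} \<times> UNIV)"
      using w by (auto simp: mixed_gens_def merge_gen_def in_lists_conv_set)
  qed (use e in auto)
  finally show ?thesis .
qed

text \<open>For a lift \<open>b\<close> of a central element, the vector
  \<open>snd (\<phi> b)\<close> pairs symmetrically with handle vectors, and nondegeneracy kills its
  handle coordinates. These are the exponent sums of a word for \<open>b\<close>, so
  \<open>word_eval_mem_C\<close> applies.\<close>

lemma centre_QB:
  shows "group_centre QB = (\<lambda>x. \<rho> (\<iota> x)) ` carrier D"
  unfolding image_rho_iota
proof
  show "Q.C \<subseteq> group_centre QB" by (rule Q.C_subset_centre)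
  show "group_centre QB \<subseteq> Q.C"
  proof
    fix c assume c: "c \<in> group_centre QB"
    then have "c \<in> carrier QB" by (simp add: group_centre_def)
    then obtain b where b: "b \<in> carrier B" "c = \<rho> b" by (auto simp: carrier_FactGroup)
    obtain w where w: "w \<in> lists (mixed_gens k n g \<times> UNIV)" and bw: "b = word_eval B \<gamma>B w"
      using B.generate_word_eval[OF B_gens] b B_generated by metis
    obtain \<phi> where \<phi>: "\<phi> \<in> hom B (model g)"
        "\<And>x. x \<in> mixed_gens k n g \<Longrightarrow> \<phi> (\<gamma>B x) = model_gen x"
        "\<And>y. y \<in> lower_central B 3 \<Longrightarrow> \<phi> y = \<one>\<^bsub>model g\<^esub>"
      by (rule model_hom) blast
    interpret \<phi>: group_hom B "model g" \<phi>
      using \<phi>(1) handle_form.group_extension B.is_group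
      by (simp add: group_hom_def group_hom_axioms_def)
    define f where "f = snd (\<phi> b)"
    have "\<phi> b = word_eval (model g) (\<phi> \<circ> \<gamma>B) w"
      unfolding bw by (rule \<phi>.hom_word_eval[OF B_gens w])
    also have "\<dots> = word_eval (model g) model_gen w"
      by (rule word_eval_cong[OF w]) (simp add: \<phi>(2))
    finally have \<phi>b: "\<phi> b = word_eval (model g) model_gen w" .
    \<comment> \<open>Letters without tilde suffice as tests: \<open>GenB i\<close> detects the
      coordinates at \<open>GenA i\<close> and \<open>GenAT i\<close>, and \<open>GenA i\<close>
      those at \<open>GenB i\<close> and \<open>GenBT i\<close>.\<close>
    have comm: "handle_form g f (unit_vec x) = handle_form g (unit_vec x) f"
      if x: "i \<in> {1..g}" "x \<in> {GenA i, GenB i}" for x i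
    proof -
      have gen: "x \<in> mixed_gens k n g" using x by (auto simp: mixed_gens_def)
      have "\<rho> b \<otimes>\<^bsub>QB\<^esub> \<rho> (\<gamma>B x) = \<rho> (\<gamma>B x) \<otimes>\<^bsub>QB\<^esub> \<rho> b"
        using group_centreD[OF c] b(2) by simp
      \<comment> \<open>Commuting in \<open>QB\<close> means that the commutator in \<open>B\<close>
        lies in the third term; \<open>\<phi>\<close> kills it, so the images commute in the
        model.\<close>
      then have "group_comm B b (\<gamma>B x) \<in> lower_central B 3"
        using LB.comm_mem_iff[OF b(1)] gB by blast
      then have "group_comm (model g) (\<phi> b) (\<phi> (\<gamma>B x)) = \<one>\<^bsub>model g\<^esub>"
        using \<phi>(3) b(1) gB[of x] by (metis \<phi>.hom_inv \<phi>.hom_mult B.inv_closed B.m_closed)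
      then have "\<phi> b \<otimes>\<^bsub>model g\<^esub> \<phi> (\<gamma>B x) = \<phi> (\<gamma>B x) \<otimes>\<^bsub>model g\<^esub> \<phi> b"
        using \<phi>.H.comm_eq_one_iff by (metis \<phi>.hom_closed b(1) gB)
      moreover have "\<phi> (\<gamma>B x) = (0, unit_vec x)" using \<phi>(2)[OF gen] x by auto
      ultimately show ?thesis by (simp add: f_def)
    qed
    have sums: "(\<Sum>l=1..g. a l * unit_vec (h i) (h l)) = a i"
        "(\<Sum>l=1..g. unit_vec (h i) (h l) * a l) = a i"
      if "i \<in> {1..g}" "inj h" for a :: "nat \<Rightarrow> int" and h :: "nat \<Rightarrow> mixed_gen" and i
    proof -
      have "(\<Sum>l=1..g. a l * unit_vec (h i) (h l)) = (\<Sum>l=1..g. if l = i then a l else 0)"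
        using that(2) by (intro sum.cong) (auto simp: unit_vec_def inj_eq)
      then show "(\<Sum>l=1..g. a l * unit_vec (h i) (h l)) = a i"
        using that(1) by (simp add: sum.delta)
      then show "(\<Sum>l=1..g. unit_vec (h i) (h l) * a l) = a i"
        by (simp add: mult.commute)
    qed
    have zero: "f x = 0" if i: "i \<in> {1..g}" and x: "x \<in> {GenA i, GenB i, GenAT i, GenBT i}" for x i
    proof -
      have inj: "inj GenA" "inj GenB" by (auto intro: injI)
      have "handle_form g f (unit_vec (GenB i)) = (2 * f (GenA i), 0, f (GenAT i))"
        "handle_form g (unit_vec (GenB i)) f = (0, 0, 0)"
        using sums[OF i inj(2), of "\<lambda>i. 2 * f (GenA i)"] sums[OF i inj(2), of "\<lambda>i. f (GenAT i)"]
        by (simp_all add: handle_form_def unit_vec_def[of _ "GenA _"] unit_vec_def[of _ "GenAT _"]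
            unit_vec_def[of _ "GenBT _"])
      moreover have "handle_form g f (unit_vec (GenA i)) = (0, 0, 0)"
        "handle_form g (unit_vec (GenA i)) f = (2 * f (GenB i), 0, f (GenBT i))"
        using sums[OF i inj(1), of "\<lambda>i. 2 * f (GenB i)"] sums[OF i inj(1), of "\<lambda>i. f (GenBT i)"]
        by (simp_all add: handle_form_def unit_vec_def[of _ "GenB _"] unit_vec_def[of _ "GenAT _"]
            unit_vec_def[of _ "GenBT _"] mult.assoc mult.left_commute)
      \<comment> \<open>One side of each symmetric pairing is zero, so the other one is too; over
        the integers the factor 2 cancels.\<close>
      ultimately show ?thesis using comm[OF i, of "GenA i"] comm[OF i, of "GenB i"] x by auto
    qed
    have "word_eval QB (\<lambda>x. \<rho> (\<gamma>B x)) w \<in> Q.C"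
    proof (rule Q.word_eval_mem_C[OF w])
      fix x i assume ix: "i \<in> {1..g}" "x \<in> {GenA i, GenB i, GenAT i, GenBT i}"
      show "exponent_sum x w = 0"
        using zero[OF ix] snd_word_eval_model[OF ix(2)] by (simp add: f_def \<phi>b)
    qed
    moreover have "c = word_eval QB (\<rho> \<circ> \<gamma>B) w"
      unfolding b(2) bw by (rule \<rho>.hom_word_eval[OF B_gens w])
    ultimately show "c \<in> Q.C" by (simp add: comp_def)
  qed
qed

end


section \<open>Factorisation criteria and the embedding of the centre\<close>

lemma (in group_hom) kernel_coset_eq:
  assumes "h x = h y" "x \<in> carrier G" "y \<in> carrier G"
  shows "kernel G H h #> x = kernel G H h #> y"
proof -
  interpret M: normal "kernel G H h" G by (rule normal_kernel)
  have "h (x \<otimes> inv y) = \<one>\<^bsub>H\<^esub>" using assms by simp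
  then have "x \<otimes> inv y \<in> kernel G H h" using assms(2,3) unfolding kernel_def by blast
  then have "x \<in> kernel G H h #> y" using M.rcos_module[OF G.is_group assms(3,2)] by blast
  then show ?thesis by (rule G.repr_independence[OF _ assms(3) M.subgroup_axioms, symmetric])
qed

text \<open>\<open>H\<close> need not be generated by the images of the generators, so the argument
  runs in the quotient by the kernel of \<open>f\<close>. There the braid generators coincide, the
  class is at most two, and the third term dies.\<close>

lemma mixed_const_lower_central_3:
  assumes P: "has_presentation G \<gamma> (mixed_gens k n g) (mixed_rel k n g)"
    and \<gamma>: "\<And>x. \<gamma> x \<in> carrier G" and kn: "3 \<le> k" "3 \<le> n"
    and H: "group H" and f: "f \<in> hom G H"
    and S: "\<And>i. i \<in> {1..<k} \<Longrightarrow> f (\<gamma> (Sig i)) = f (\<gamma> (Sig 1))"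
    and T: "\<And>i. i \<in> {1..<n} \<Longrightarrow> f (\<gamma> (SigT i)) = f (\<gamma> (SigT 1))"
    and x: "x \<in> lower_central G 3"
  shows "f x = \<one>\<^bsub>H\<^esub>"
proof -
  let ?M = "kernel G H f"
  interpret G: group G using P by (simp add: has_presentation_def)
  interpret f: group_hom G H f
    using H f G.is_group by (simp add: group_hom_def group_hom_axioms_def)
  interpret M: normal ?M G by (rule f.normal_kernel)
  interpret L: normal "lower_central G 3" G by (rule G.lower_central_normal)
  interpret q: group_hom G "G Mod ?M" "(#>\<^bsub>G\<^esub>) ?M" by (rule M.group_hom_Mod)
  interpret K: mixed_quotient_const "G Mod ?M" "\<lambda>x. ?M #>\<^bsub>G\<^esub> \<gamma> x" k n g
  proof (rule mixed_quotient_const.intro[OF _ mixed_quotient_const_axioms.intro])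
    show "mixed_quotient (G Mod ?M) (\<lambda>x. ?M #>\<^bsub>G\<^esub> \<gamma> x) k n g"
      by (rule mixed_quotient_Mod[OF P \<gamma> f.normal_kernel kn])
    show "?M #>\<^bsub>G\<^esub> \<gamma> (Sig i) = ?M #>\<^bsub>G\<^esub> \<gamma> (Sig 1)" if "i \<in> {1..<k}" for i
      by (rule f.kernel_coset_eq[OF S[OF that] \<gamma> \<gamma>])
    show "?M #>\<^bsub>G\<^esub> \<gamma> (SigT i) = ?M #>\<^bsub>G\<^esub> \<gamma> (SigT 1)" if "i \<in> {1..<n}" for i
      by (rule f.kernel_coset_eq[OF T[OF that] \<gamma> \<gamma>])
  qed
  have "?M #>\<^bsub>G\<^esub> x = \<one>\<^bsub>G Mod ?M\<^esub>" using x by (rule q.lower_central_3_trivial[OF K.class_two])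
  moreover have "x \<in> carrier G" using x L.subset by blast
  ultimately have "x \<in> ?M" using M.rcos_eq_one_iff by simp
  then show ?thesis unfolding kernel_def by blast
qed

context braid_inclusion
begin

lemma iota_lower_central: "x \<in> lower_central D 2 \<Longrightarrow> \<iota> x \<in> lower_central B 3"
proof -
  assume x: "x \<in> lower_central D 2"
  obtain \<alpha> where \<alpha>: "\<alpha> \<in> hom QD QB" "\<And>x. x \<in> carrier D \<Longrightarrow> \<alpha> (r x) = \<rho> (\<iota> x)"
    by (rule alpha_exists) blast
  have xD: "x \<in> carrier D" using x LD.subset by blast
  then have "r x = \<one>\<^bsub>QD\<^esub>" using x LD.rcos_eq_one_iff by simp
  then have "\<rho> (\<iota> x) = \<one>\<^bsub>QB\<^esub>"
    using \<alpha>(2)[OF xD] hom_one[OF \<alpha>(1) r.H.is_group \<rho>.H.is_group] by (simp only:)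
  then show "\<iota> x \<in> lower_central B 3"
    using LB.rcos_eq_one_iff[OF \<iota>.hom_closed[OF xD]] by simp
qed

text \<open>Proved as a cycle: (a) gives (b) by \<open>iota_lower_central\<close>, (b) gives (c)
  because the braid generators of each kind coincide in \<open>QD\<close>, and (c) gives (a) by
  \<open>mixed_const_lower_central_3\<close>.\<close>

lemma factors_iff:
  assumes H: "group H" and f: "f \<in> hom B H"
  shows "factors_through B QB H f \<rho> \<longleftrightarrow> factors_through D QD H (f \<circ> \<iota>) r" (is "?a \<longleftrightarrow> ?b")
    and "factors_through D QD H (f \<circ> \<iota>) r \<longleftrightarrow>
      (\<exists>s\<in>carrier H. \<exists>t\<in>carrier H. f ` \<gamma>B ` Sig ` {1..<k} = {s} \<and> f ` \<gamma>B ` SigT ` {1..<n} = {t})"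
      (is "_ \<longleftrightarrow> ?c")
proof -
  interpret f: group_hom B H f using H f B.is_group by (simp add: group_hom_def group_hom_axioms_def)
  have fi: "f \<circ> \<iota> \<in> hom D H" using \<iota>_hom f by (rule hom_compose)
  have a: "?a \<longleftrightarrow> (\<forall>x\<in>lower_central B 3. f x = \<one>\<^bsub>H\<^esub>)"
    by (rule B.factors_through_Mod_iff[OF B.lower_central_normal(2) H f])
  have b: "?b \<longleftrightarrow> (\<forall>x\<in>lower_central D 2. (f \<circ> \<iota>) x = \<one>\<^bsub>H\<^esub>)"
    by (rule D.factors_through_Mod_iff[OF D.lower_central_normal(1) H fi])
  have ab: "?b" if "?a" using that iota_lower_central unfolding a b by simp
  have bc: "?c" if b: "?b"
  proof -
    obtain h where h: "\<And>x. x \<in> carrier D \<Longrightarrow> f (\<iota> x) = h (r x)"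
      using b by (auto simp: factors_through_def)
    have S: "f (\<gamma>B (Sig i)) = f (\<gamma>B (Sig 1))" if i: "i \<in> {1..<k}" for i
    proof -
      have "\<iota> (\<gamma>D (Sig i)) = \<gamma>B (Sig i)" "\<iota> (\<gamma>D (Sig 1)) = \<gamma>B (Sig 1)"
        using i by (auto intro!: \<iota>_gens simp: mixed_gens_def)
      then show ?thesis using h[of "\<gamma>D (Sig i)"] h[of "\<gamma>D (Sig 1)"] R.Sig_eq[OF i] by simp
    qed
    have T: "f (\<gamma>B (SigT i)) = f (\<gamma>B (SigT 1))" if i: "i \<in> {1..<n}" for i
    proof -
      have "\<iota> (\<gamma>D (SigT i)) = \<gamma>B (SigT i)" "\<iota> (\<gamma>D (SigT 1)) = \<gamma>B (SigT 1)"
        using i by (auto intro!: \<iota>_gens simp: mixed_gens_def)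
      then show ?thesis using h[of "\<gamma>D (SigT i)"] h[of "\<gamma>D (SigT 1)"] R.SigT_eq[OF i] by simp
    qed
    have "f ` \<gamma>B ` Sig ` {1..<k} = (\<lambda>_. f (\<gamma>B (Sig 1))) ` {1..<k}"
      "f ` \<gamma>B ` SigT ` {1..<n} = (\<lambda>_. f (\<gamma>B (SigT 1))) ` {1..<n}"
      unfolding image_image by (rule image_cong[OF HOL.refl], erule S T)+
    then have "f ` \<gamma>B ` Sig ` {1..<k} = {f (\<gamma>B (Sig 1))}"
      "f ` \<gamma>B ` SigT ` {1..<n} = {f (\<gamma>B (SigT 1))}"
      \<comment> \<open>The index ranges are nonempty, so a constant map has a singleton as
        image.\<close>
      using k3 n3 by (simp_all add: image_constant_conv)
    then show ?thesis by (intro bexI[of _ "f (\<gamma>B (Sig 1))"] bexI[of _ "f (\<gamma>B (SigT 1))"]) auto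
  qed
  have ca: "?a" if c: "?c"
  proof -
    have "f (\<gamma>B (Sig i)) = f (\<gamma>B (Sig 1))" if "i \<in> {1..<k}" for i
    proof -
      have "f (\<gamma>B (Sig i)) \<in> f ` \<gamma>B ` Sig ` {1..<k}" "f (\<gamma>B (Sig 1)) \<in> f ` \<gamma>B ` Sig ` {1..<k}"
        using that by auto
      then show ?thesis using c by (metis singletonD)
    qed
    moreover have "f (\<gamma>B (SigT i)) = f (\<gamma>B (SigT 1))" if "i \<in> {1..<n}" for i
    proof -
      have "f (\<gamma>B (SigT i)) \<in> f ` \<gamma>B ` SigT ` {1..<n}" "f (\<gamma>B (SigT 1)) \<in> f ` \<gamma>B ` SigT ` {1..<n}"
        using that by auto
      then show ?thesis using c by (metis singletonD)
    qed
    ultimately show ?thesis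
      using mixed_const_lower_central_3[OF presentation_B gB k3 n3 H f] unfolding a by blast
  qed
  show "?a \<longleftrightarrow> ?b" "?b \<longleftrightarrow> ?c" using ab bc ca by blast+
qed

text \<open>A nontrivial normal subgroup of a group of class two meets the centre.\<close>

lemma inj_on_iff_centre:
  assumes H: "group H" and f: "f \<in> hom QB H"
    and \<alpha>: "\<alpha> \<in> hom QD QB" "inj_on \<alpha> (carrier QD)" "\<alpha> ` carrier QD = group_centre QB"
  shows "inj_on f (carrier QB) \<longleftrightarrow> inj_on (f \<circ> \<alpha>) (carrier QD)"
proof
  assume "inj_on f (carrier QB)"
  then show "inj_on (f \<circ> \<alpha>) (carrier QD)"
    using \<alpha> by (intro comp_inj_on) (auto simp: group_centre_def intro: inj_on_subset)
next
  assume inj: "inj_on (f \<circ> \<alpha>) (carrier QD)"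
  interpret f: group_hom QB H f
    using H f \<rho>.H.is_group by (simp add: group_hom_def group_hom_axioms_def)
  have "inj_on f (group_centre QB)" using inj_on_imageI[OF inj] \<alpha>(3) by simp
  moreover have "\<one>\<^bsub>QB\<^esub> \<in> group_centre QB"
    using \<rho>.H.centre_subgroup by (rule subgroup.one_closed)
  ultimately have triv: "c = \<one>\<^bsub>QB\<^esub>" if "c \<in> group_centre QB" "f c = \<one>\<^bsub>H\<^esub>" for c
    using that f.hom_one by (metis inj_onD)
  show "inj_on f (carrier QB)"
    unfolding f.inj_on_one_iff
  proof (intro allI impI)
    fix x assume x: "x \<in> carrier QB" "f x = \<one>\<^bsub>H\<^esub>"
    \<comment> \<open>The commutator of the kernel element \<open>x\<close> with \<open>y\<close> is
      central and again in the kernel, so \<open>triv\<close> applies. Hence \<open>x\<close> is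
      itself central, and \<open>triv\<close> applies once more.\<close>
    have "x \<otimes>\<^bsub>QB\<^esub> y = y \<otimes>\<^bsub>QB\<^esub> x" if y: "y \<in> carrier QB" for y
    proof -
      have "f (group_comm QB x y) = \<one>\<^bsub>H\<^esub>"
        using x y by (simp del: mult_FactGroup)
      moreover have "group_comm QB x y \<in> group_centre QB"
        using class_two_QB x(1) y unfolding class_two_def by blast
      ultimately show ?thesis using triv \<rho>.H.comm_eq_one_iff[OF x(1) y] by blast
    qed
    then have "x \<in> group_centre QB" using x(1) unfolding group_centre_def by blast
    then show "x = \<one>\<^bsub>QB\<^esub>" using triv x(2) by blast
  qed
qed

text \<open>Elements of \<open>QD\<close> are classes of elements of \<open>D\<close>, so
  injectivity reduces to \<open>rho_iota_eq_one\<close> and the image is that of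
  \<open>\<rho> \<circ> \<iota>\<close>, which is the centre by \<open>centre_QB\<close>.\<close>

lemma centre_embedding:
  obtains \<alpha> where "\<alpha> \<in> hom QD QB" "inj_on \<alpha> (carrier QD)"
    "\<And>x. x \<in> carrier D \<Longrightarrow> \<alpha> (r x) = \<rho> (\<iota> x)" "\<alpha> ` carrier QD = group_centre QB"
proof -
  obtain \<alpha> where \<alpha>: "\<alpha> \<in> hom QD QB" "\<And>x. x \<in> carrier D \<Longrightarrow> \<alpha> (r x) = \<rho> (\<iota> x)"
    by (rule alpha_exists) blast
  interpret \<alpha>: group_hom QD QB \<alpha>
    using \<alpha>(1) r.H.is_group \<rho>.H.is_group by (simp add: group_hom_def group_hom_axioms_def)
  have car: "carrier QD = r ` carrier D" by (simp add: carrier_FactGroup)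
  have "inj_on \<alpha> (carrier QD)"
    unfolding \<alpha>.inj_on_one_iff
  proof (intro allI impI)
    fix x assume "x \<in> carrier QD" and one: "\<alpha> x = \<one>\<^bsub>QB\<^esub>"
    then obtain d where d: "d \<in> carrier D" "x = r d" using car by blast
    then show "x = \<one>\<^bsub>QD\<^esub>" using rho_iota_eq_one[OF d(1)] one \<alpha>(2)[OF d(1)] by (simp only:)
  qed
  moreover have "\<alpha> ` carrier QD = group_centre QB"
    unfolding car image_image centre_QB using \<alpha>(2) by (intro image_cong) auto
  ultimately show thesis using that \<alpha> by blast
qed

end

theorem corollary3p11:
  fixes k n g :: nat
    and X :: "'a topology" and e :: "complex \<Rightarrow> 'a" and p :: "nat \<Rightarrow> complex"
    and B :: "(real \<Rightarrow> (nat \<Rightarrow> 'a) set) set monoid"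
    and D :: "(real \<Rightarrow> (nat \<Rightarrow> complex) set) set monoid"
    and \<gamma>B :: "mixed_gen \<Rightarrow> (real \<Rightarrow> (nat \<Rightarrow> 'a) set) set"
    and \<gamma>D :: "mixed_gen \<Rightarrow> (real \<Rightarrow> (nat \<Rightarrow> complex) set) set"
    and H :: "('h, 'm) monoid_scheme"
    and \<rho>H :: "(real \<Rightarrow> (nat \<Rightarrow> 'a) set) set \<Rightarrow> 'h"
  assumes kng: "k \<ge> 3" "n \<ge> 3" "g \<ge> 1"
    and surface: "one_holed_surface g X"
    and embedding: "embedding_map disc X e"
    and base_point: "p \<in> topspace (config_space (k + n) disc)"
    and B_def: "B = mixed_braid_group k n X (push_config (k + n) e p)"
    and D_def: "D = mixed_braid_group k n disc p"
    and iota_def: "\<iota> = mixed_braid_map k n X e p"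
    and presentation_B: "has_presentation B \<gamma>B (mixed_gens k n g) (mixed_rel k n g)"
    and presentation_D: "has_presentation D \<gamma>D (mixed_gens k n 0) (mixed_rel k n 0)"
    and iota_gens: "\<forall>x\<in>mixed_gens k n 0. \<iota> (\<gamma>D x) = \<gamma>B x"
    and QB_def: "QB = B Mod lower_central B 3"
    and rho_def: "\<rho> = (\<lambda>x. lower_central B 3 #>\<^bsub>B\<^esub> x)"
    and QD_def: "QD = D Mod lower_central D 2"
    and r_def: "r = (\<lambda>x. lower_central D 2 #>\<^bsub>D\<^esub> x)"
    and H: "group H" "\<rho>H \<in> hom B H"
  shows
    "(factors_through B QB H \<rho>H \<rho> \<longleftrightarrow> factors_through D QD H (\<rho>H \<circ> \<iota>) r) \<and>
     (factors_through D QD H (\<rho>H \<circ> \<iota>) r \<longleftrightarrow>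
        (\<exists>s\<in>carrier H. \<exists>t\<in>carrier H.
           \<rho>H ` \<gamma>B ` Sig ` {1..<k} = {s} \<and> \<rho>H ` \<gamma>B ` SigT ` {1..<n} = {t})) \<and>
     (\<exists>\<alpha>\<in>hom QD QB.
        inj_on \<alpha> (carrier QD) \<and>
        (\<forall>x\<in>carrier D. \<alpha> (r x) = \<rho> (\<iota> x)) \<and>
        \<alpha> ` carrier QD = group_centre QB \<and>
        (\<forall>\<rho>3\<in>hom QB H. inj_on \<rho>3 (carrier QB) \<longleftrightarrow> inj_on (\<rho>3 \<circ> \<alpha>) (carrier QD)) \<and>
        (\<forall>\<rho>2\<in>hom QD H. (\<forall>x\<in>carrier D. \<rho>H (\<iota> x) = \<rho>2 (r x)) \<longrightarrow>
           (\<exists>\<rho>3\<in>hom QB H.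
              (\<forall>x\<in>carrier B. \<rho>3 (\<rho> x) = \<rho>H x) \<and>
              (\<forall>y\<in>carrier QD. \<rho>2 y = \<rho>3 (\<alpha> y)) \<and>
              (inj_on \<rho>3 (carrier QB) \<longleftrightarrow> inj_on \<rho>2 (carrier QD)) \<and>
              (inj_on \<rho>2 (carrier QD) \<and> \<rho>H ` carrier B = carrier H \<longrightarrow> \<rho>3 \<in> iso QB H))))"
proof -
  \<comment> \<open>The locale asks for generator maps that are total in the carriers; the identity
    is the default value off the generating sets.\<close>
  define \<gamma>B' where "\<gamma>B' x = (if x \<in> mixed_gens k n g then \<gamma>B x else \<one>\<^bsub>B\<^esub>)" for x
  define \<gamma>D' where "\<gamma>D' x = (if x \<in> mixed_gens k n 0 then \<gamma>D x else \<one>\<^bsub>D\<^esub>)" for x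
  have B': "has_presentation B \<gamma>B' (mixed_gens k n g) (mixed_rel k n g)"
    by (rule has_presentation_cong[OF presentation_B]) (simp add: \<gamma>B'_def)
  have D': "has_presentation D \<gamma>D' (mixed_gens k n 0) (mixed_rel k n 0)"
    by (rule has_presentation_cong[OF presentation_D]) (simp add: \<gamma>D'_def)
  \<comment> \<open>Supplies the continuity and injectivity of \<open>e\<close> from which
    \<open>mixed_braid_map_in_hom\<close> makes \<open>\<iota>\<close> a homomorphism.\<close>
  have e_homeo: "homeomorphic_map disc (subtopology X (e ` topspace disc)) e"
    using embedding by (simp add: embedding_map_def)
  have e: "continuous_map disc X e"
    using homeomorphic_imp_continuous_map[OF e_homeo] by (rule continuous_map_into_fulltopology)
  note e = e homeomorphic_imp_injective_map[OF e_homeo]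
  interpret braid_inclusion B D \<gamma>B' \<gamma>D' \<iota> k n g
  proof
    show "\<gamma>B' x \<in> carrier B" for x
      using presentation_B group.is_monoid[of B] monoid.one_closed[of B]
      by (auto simp: \<gamma>B'_def has_presentation_def)
    show "\<gamma>D' x \<in> carrier D" for x
      using presentation_D group.is_monoid[of D] monoid.one_closed[of D]
      by (auto simp: \<gamma>D'_def has_presentation_def)
    show "\<iota> \<in> hom D B"
      unfolding iota_def D_def B_def by (rule mixed_braid_map_in_hom[OF e])
    show "\<iota> (\<gamma>D' x) = \<gamma>B' x" if "x \<in> mixed_gens k n 0" for x
    proof -
      have "x \<in> mixed_gens k n g" using that by (auto simp: mixed_gens_def)
      then show ?thesis using that iota_gens by (simp add: \<gamma>B'_def \<gamma>D'_def)
    qed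
  qed (use kng B' D' in auto)
  have gens: "\<gamma>B' ` Sig ` {1..<k} = \<gamma>B ` Sig ` {1..<k}" "\<gamma>B' ` SigT ` {1..<n} = \<gamma>B ` SigT ` {1..<n}"
    by (intro image_cong; auto simp: \<gamma>B'_def mixed_gens_def)+
  obtain \<alpha> where \<alpha>: "\<alpha> \<in> hom QD QB" "inj_on \<alpha> (carrier QD)"
      "\<And>x. x \<in> carrier D \<Longrightarrow> \<alpha> (r x) = \<rho> (\<iota> x)" "\<alpha> ` carrier QD = group_centre QB"
    unfolding QD_def QB_def rho_def r_def by (rule centre_embedding) blast
  note inj_iff = inj_on_iff_centre[OF H(1), folded QB_def QD_def, OF _ \<alpha>(1,2,4)]
  note factors = factors_iff[OF H, unfolded gens, folded QB_def QD_def rho_def r_def]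
  have carD: "carrier QD = r ` carrier D" and carB: "carrier QB = \<rho> ` carrier B"
    by (simp_all add: QD_def QB_def r_def rho_def carrier_FactGroup)
  have iv: "\<exists>\<rho>3\<in>hom QB H.
      (\<forall>x\<in>carrier B. \<rho>3 (\<rho> x) = \<rho>H x) \<and> (\<forall>y\<in>carrier QD. \<rho>2 y = \<rho>3 (\<alpha> y)) \<and>
      (inj_on \<rho>3 (carrier QB) \<longleftrightarrow> inj_on \<rho>2 (carrier QD)) \<and>
      (inj_on \<rho>2 (carrier QD) \<and> \<rho>H ` carrier B = carrier H \<longrightarrow> \<rho>3 \<in> iso QB H)"
    if \<rho>2: "\<rho>2 \<in> hom QD H" "\<forall>x\<in>carrier D. \<rho>H (\<iota> x) = \<rho>2 (r x)" for \<rho>2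
  proof -
    \<comment> \<open>The given \<open>\<rho>2\<close> witnesses condition (b), so condition (a)
      provides \<open>\<rho>3\<close>.\<close>
    have "factors_through D QD H (\<rho>H \<circ> \<iota>) r"
      unfolding factors_through_def using \<rho>2 by auto
    then have "factors_through B QB H \<rho>H \<rho>" using factors(1) by blast
    then obtain \<rho>3 where \<rho>3: "\<rho>3 \<in> hom QB H" "\<forall>x\<in>carrier B. \<rho>H x = \<rho>3 (\<rho> x)"
      unfolding factors_through_def by blast
    have \<rho>2_eq: "\<rho>2 y = \<rho>3 (\<alpha> y)" if "y \<in> carrier QD" for y
      using that \<alpha>(3) \<rho>2(2) \<rho>3(2) \<iota>.hom_closed unfolding carD by auto
    then have inj: "inj_on \<rho>3 (carrier QB) \<longleftrightarrow> inj_on \<rho>2 (carrier QD)"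
      using inj_iff[OF \<rho>3(1)] inj_on_cong[of "carrier QD" \<rho>2 "\<rho>3 \<circ> \<alpha>"] by simp
    \<comment> \<open>As \<open>\<rho>\<close> maps onto \<open>QB\<close>, surjectivity of
      \<open>\<rho>H\<close> passes to \<open>\<rho>3\<close>.\<close>
    have "\<rho>3 ` carrier QB = \<rho>H ` carrier B"
      unfolding carB image_image using \<rho>3(2) by (intro image_cong) auto
    then have "\<rho>3 \<in> iso QB H" if "inj_on \<rho>2 (carrier QD)" "\<rho>H ` carrier B = carrier H"
      using that inj \<rho>3(1) by (simp add: iso_def bij_betw_def)
    then show ?thesis using \<rho>3 \<rho>2_eq inj by (intro bexI[of _ \<rho>3]) auto
  qed
  show ?thesis
  proof (rule conjI[OF factors(1) conjI[OF factors(2)]], rule bexI[OF _ \<alpha>(1)], intro conjI ballI)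
    show "inj_on \<alpha> (carrier QD)" by (rule \<alpha>(2))
    show "\<alpha> (r x) = \<rho> (\<iota> x)" if "x \<in> carrier D" for x using that by (rule \<alpha>(3))
    show "\<alpha> ` carrier QD = group_centre QB" by (rule \<alpha>(4))
    show "inj_on \<rho>3 (carrier QB) \<longleftrightarrow> inj_on (\<rho>3 \<circ> \<alpha>) (carrier QD)" if "\<rho>3 \<in> hom QB H" for \<rho>3
      using that by (rule inj_iff)
  qed (rule impI, rule iv)
qed

end
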